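(* For every integer $n\ge 3$, $D_{\max}(K_n)=D'_{\max}(K_n)=2$, $\chi_{D,\max}(K_n)=n$, and $\chi'_{D,\max}(K_n)=\chi'(K_n)$, where $K_n$ is the complete graph of order $n$ and $\chi'$ denotes the chromatic index.
   Context: An orientation of a simple graph assigns one direction to each edge. An automorphism of an oriented graph is a permutation $\phi$ of its vertices such that $\phi(u)\phi(v)$ is an arc whenever $uv$ is an arc. An $r$-vertex-labelling maps vertices to $\{1,\dots,r\}$, an $r$-arc-labelling maps arcs to $\{1,\dots,r\}$; colourings are proper labellings (adjacent vertices, resp. arcs sharing an end-vertex, get distinct labels). A labelling $\lambda$ is distinguishing if the only automorphism $\phi$ with $\lambda(\phi(u))=\lambda(u)$ for all vertices (resp. $\lambda(\phi(u)\phi(v))=\lambda(uv)$ for all arcs) is the identity. For an oriented graph $\vec G$, $D(\vec G)$, $\chi_D(\vec G)$, $D'(\vec G)$, $\chi'_D(\vec G)$ are the least $r$ for which $\vec G$ admits a distinguishing $r$-vertex-labelling, $r$-vertex-colouring, $r$-arc-labelling, $r$-arc-colouring. For an undirected graph $G$, $D_{\max}(G)$, $\chi_{D,\max}(G)$, $D'_{\max}(G)$, $\chi'_{D,\max}(G)$ are the maxima of these respective parameters over all orientations of $G$. *)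

theory Defs
  imports "Graph_Theory.Kuratowski" "HOL-Combinatorics.Permutations" "HOL-Library.FuncSet"
begin

text \<open>
  As in the Graph_Theory library, an undirected graph is a symmetric digraph: an edge joining
  \<open>u\<close> and \<open>v\<close> is represented by the two arcs \<open>(u, v)\<close> and \<open>(v, u)\<close>. An orientation
  keeps exactly one of the two.
\<close>

definition orientations :: "'a pair_pre_digraph \<Rightarrow> 'a pair_pre_digraph set" where
  "orientations G = {H. pverts H = pverts G \<and> parcs H \<subseteq> parcs G \<and>
     (\<forall>(u, v) \<in> parcs G. (u, v) \<in> parcs H \<longleftrightarrow> (v, u) \<notin> parcs H)}"

definition automorphism :: "'a pair_pre_digraph \<Rightarrow> ('a \<Rightarrow> 'a) \<Rightarrow> bool" where
  "automorphism H \<phi> \<longleftrightarrow> \<phi> permutes pverts H \<and>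
     (\<forall>(u, v) \<in> parcs H. (\<phi> u, \<phi> v) \<in> parcs H)"

definition vertex_labelling :: "'a pair_pre_digraph \<Rightarrow> nat \<Rightarrow> ('a \<Rightarrow> nat) \<Rightarrow> bool" where
  "vertex_labelling H r l \<longleftrightarrow> l \<in> pverts H \<rightarrow> {1..r}"

definition arc_labelling :: "'a pair_pre_digraph \<Rightarrow> nat \<Rightarrow> ('a \<times> 'a \<Rightarrow> nat) \<Rightarrow> bool" where
  "arc_labelling H r l \<longleftrightarrow> l \<in> parcs H \<rightarrow> {1..r}"

definition vertex_colouring :: "'a pair_pre_digraph \<Rightarrow> nat \<Rightarrow> ('a \<Rightarrow> nat) \<Rightarrow> bool" where
  "vertex_colouring H r l \<longleftrightarrow> vertex_labelling H r l \<and> (\<forall>(u, v) \<in> parcs H. l u \<noteq> l v)"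

definition arc_colouring :: "'a pair_pre_digraph \<Rightarrow> nat \<Rightarrow> ('a \<times> 'a \<Rightarrow> nat) \<Rightarrow> bool" where
  "arc_colouring H r l \<longleftrightarrow> arc_labelling H r l \<and>
     (\<forall>a \<in> parcs H. \<forall>b \<in> parcs H.
        a \<noteq> b \<and> {fst a, snd a} \<inter> {fst b, snd b} \<noteq> {} \<longrightarrow> l a \<noteq> l b)"

text \<open>
  In the next two definitions \<open>\<phi> = id\<close> is the identity on the vertices, since a permutation of
  \<open>pverts H\<close> (in the sense of \<open>permutes\<close>) fixes everything outside \<open>pverts H\<close>.
\<close>

definition vertex_distinguishing :: "'a pair_pre_digraph \<Rightarrow> ('a \<Rightarrow> nat) \<Rightarrow> bool" where
  "vertex_distinguishing H l \<longleftrightarrow>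
     (\<forall>\<phi>. automorphism H \<phi> \<and> (\<forall>u \<in> pverts H. l (\<phi> u) = l u) \<longrightarrow> \<phi> = id)"

definition arc_distinguishing :: "'a pair_pre_digraph \<Rightarrow> ('a \<times> 'a \<Rightarrow> nat) \<Rightarrow> bool" where
  "arc_distinguishing H l \<longleftrightarrow>
     (\<forall>\<phi>. automorphism H \<phi> \<and> (\<forall>(u, v) \<in> parcs H. l (\<phi> u, \<phi> v) = l (u, v)) \<longrightarrow> \<phi> = id)"

definition dist_number :: "'a pair_pre_digraph \<Rightarrow> nat" where
  "dist_number H = (LEAST r. \<exists>l. vertex_labelling H r l \<and> vertex_distinguishing H l)"

definition dist_chromatic_number :: "'a pair_pre_digraph \<Rightarrow> nat" where
  "dist_chromatic_number H = (LEAST r. \<exists>l. vertex_colouring H r l \<and> vertex_distinguishing H l)"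

definition dist_index :: "'a pair_pre_digraph \<Rightarrow> nat" where
  "dist_index H = (LEAST r. \<exists>l. arc_labelling H r l \<and> arc_distinguishing H l)"

definition dist_chromatic_index :: "'a pair_pre_digraph \<Rightarrow> nat" where
  "dist_chromatic_index H = (LEAST r. \<exists>l. arc_colouring H r l \<and> arc_distinguishing H l)"

text \<open>A finite graph has finitely many orientations, so the maxima below are attained.\<close>

definition D_max :: "'a pair_pre_digraph \<Rightarrow> nat" where
  "D_max G = Max (dist_number ` orientations G)"

definition chi_D_max :: "'a pair_pre_digraph \<Rightarrow> nat" where
  "chi_D_max G = Max (dist_chromatic_number ` orientations G)"

definition D'_max :: "'a pair_pre_digraph \<Rightarrow> nat" where
  "D'_max G = Max (dist_index ` orientations G)"

definition chi'_D_max :: "'a pair_pre_digraph \<Rightarrow> nat" where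
  "chi'_D_max G = Max (dist_chromatic_index ` orientations G)"

definition edges :: "'a pair_pre_digraph \<Rightarrow> 'a set set" where
  "edges G = {{u, v} |u v. (u, v) \<in> parcs G}"

definition edge_colouring :: "'a pair_pre_digraph \<Rightarrow> nat \<Rightarrow> ('a set \<Rightarrow> nat) \<Rightarrow> bool" where
  "edge_colouring G r c \<longleftrightarrow> c \<in> edges G \<rightarrow> {1..r} \<and>
     (\<forall>e \<in> edges G. \<forall>f \<in> edges G. e \<noteq> f \<and> e \<inter> f \<noteq> {} \<longrightarrow> c e \<noteq> c f)"

definition chromatic_index :: "'a pair_pre_digraph \<Rightarrow> nat" where
  "chromatic_index G = (LEAST r. \<exists>c. edge_colouring G r c)"

end

theory Submission
  imports Defs "HOL-Combinatorics.Cycles"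
begin

text \<open>
  The only hard part is that every tournament has a set of vertices preserved by no nontrivial
  automorphism. As all automorphisms of a tournament have odd order, this is a case of Gluck's theorem
  on groups of odd order; the proof below is elementary and does not use the solvability of such
  groups. Intransitive and imprimitive actions reduce to smaller ones. For a primitive action let \<open>E\<close>
  be an orbital of least outdegree \<open>d\<close>. Every nontrivial symmetry moves more than \<open>d\<close> vertices, so a
  set \<open>S\<close> that contains all out-neighbours of \<open>v\<close> and breaks the stabiliser of \<open>v\<close> on the remaining
  vertices is asymmetric as soon as its symmetries fix \<open>v\<close>. Breaking the remaining vertices in the order
  of decreasing distance to \<open>v\<close> in the graph without the out-neighbours of \<open>v\<close> makes \<open>v\<close> recognisable
  as a vertex outside \<open>S\<close> whose out-neighbours all belong to \<open>S\<close>: any other such vertex is separated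
  from \<open>v\<close> by the out-neighbours of \<open>v\<close>, and two vertices cannot separate each other in this way,
  because the digraph \<open>E\<close> is \<open>d\<close>-connected.
\<close>

section \<open>Actions of groups of odd order\<close>

text \<open>Inverses on \<open>V\<close> come from powers, and values outside \<open>V\<close> are
  left open, so that the same maps act on any invariant subset.\<close>

locale odd_action =
  fixes F :: "('a \<Rightarrow> 'a) set" and V :: "'a set"
  assumes finite_V: "finite V"
    and id_mem: "id \<in> F"
    and comp_mem: "f \<in> F \<Longrightarrow> g \<in> F \<Longrightarrow> f \<circ> g \<in> F"
    and closed: "f \<in> F \<Longrightarrow> x \<in> V \<Longrightarrow> f x \<in> V"
    and odd_order: "f \<in> F \<Longrightarrow> \<exists>k. odd k \<and> (\<forall>x\<in>V. (f ^^ k) x = x)"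

definition asymmetric_set :: "('a \<Rightarrow> 'a) set \<Rightarrow> 'a set \<Rightarrow> 'a set \<Rightarrow> bool" where
  "asymmetric_set F V S \<longleftrightarrow> S \<subseteq> V \<and> (\<forall>f\<in>F. f ` S = S \<longrightarrow> (\<forall>x\<in>V. f x = x))"

context odd_action
begin

lemma funpow_mem: "f \<in> F \<Longrightarrow> f ^^ k \<in> F"
  by (induction k) (auto simp: id_mem comp_mem)

lemma inverse:
  assumes "f \<in> F"
  obtains g where "g \<in> F" "\<And>x. x \<in> V \<Longrightarrow> g (f x) = x" "\<And>x. x \<in> V \<Longrightarrow> f (g x) = x"
proof -
  obtain k where k: "odd k" "\<forall>x\<in>V. (f ^^ k) x = x" using odd_order assms by blast
  then obtain j where j: "k = Suc j" by (cases k) auto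
  show thesis
  proof (rule that[of "f ^^ j"])
    show "f ^^ j \<in> F" by (rule funpow_mem[OF assms])
    show "(f ^^ j) (f x) = x" if "x \<in> V" for x
      using k(2) that by (simp add: j funpow_swap1)
    show "f ((f ^^ j) x) = x" if "x \<in> V" for x
      using k(2) that by (simp add: j)
  qed
qed

lemma inj_on_V: "f \<in> F \<Longrightarrow> inj_on f V"
  by (metis inj_on_inverseI inverse)

lemma image_V: "f \<in> F \<Longrightarrow> f ` V = V"
  by (metis closed endo_inj_surj finite_V image_subsetI inj_on_V)

lemma image_eq_self:
  assumes "f \<in> F" "A \<subseteq> V" "f ` A \<subseteq> A"
  shows "f ` A = A"
  using endo_inj_surj[OF finite_subset[OF assms(2) finite_V] assms(3)]
    inj_on_subset[OF inj_on_V[OF assms(1)] assms(2)] by blast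

lemma image_mem_iff: "f \<in> F \<Longrightarrow> A \<subseteq> V \<Longrightarrow> x \<in> V \<Longrightarrow> f x \<in> f ` A \<longleftrightarrow> x \<in> A"
  by (meson inj_on_V inj_on_image_mem_iff)

text \<open>Even powers of \<open>f\<close> would fix \<open>x\<close> and odd ones send it to
  \<open>y\<close>, yet some odd power is trivial on \<open>V\<close>. Both
  \<open>orbital_antisym\<close> and the step \<open>no_flip\<close> rest on this.\<close>

lemma no_swap:
  assumes "f \<in> F" "x \<in> V" "f x = y" "f y = x"
  shows "x = y"
proof -
  obtain k where k: "odd k" "(f ^^ k) x = x" using odd_order assms by blast
  have "(f ^^ (2 * m)) x = x" for m
    by (induction m) (simp_all add: assms)
  moreover obtain m where "k = Suc (2 * m)" using k(1) by (elim oddE) simp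
  ultimately show ?thesis using k(2) assms(3) by simp
qed

lemma subaction:
  assumes "K \<subseteq> F" "id \<in> K" "\<And>f g. f \<in> K \<Longrightarrow> g \<in> K \<Longrightarrow> f \<circ> g \<in> K" "W \<subseteq> V"
    and "\<And>f x. f \<in> K \<Longrightarrow> x \<in> W \<Longrightarrow> f x \<in> W"
  shows "odd_action K W"
proof
  show "finite W" using assms(4) finite_V by (rule finite_subset)
  show "\<exists>k. odd k \<and> (\<forall>x\<in>W. (f ^^ k) x = x)" if "f \<in> K" for f
    using odd_order[of f] that assms(1,4) by (metis subsetD)
qed (rule assms; assumption)+

text \<open>Discarding the orbits contained in \<open>S\<close> loses nothing: a map preserving the
  rest preserves \<open>S\<close>, because it cannot take a vertex of a discarded orbit out of
  \<open>S\<close>.\<close>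

lemma asymmetric_set_no_orbit:
  assumes "asymmetric_set F V S"
  obtains X where "asymmetric_set F V X" "\<And>x. x \<in> V \<Longrightarrow> \<exists>f\<in>F. f x \<notin> X"
proof (rule that[of "{x \<in> S. \<exists>f\<in>F. f x \<notin> S}"])
  let ?X = "{x \<in> S. \<exists>f\<in>F. f x \<notin> S}"
  have S: "S \<subseteq> V" using assms by (simp add: asymmetric_set_def)
  show "asymmetric_set F V ?X"
    unfolding asymmetric_set_def
  proof (intro conjI ballI impI)
    show "?X \<subseteq> V" using S by auto
    fix f x assume f: "f \<in> F" "f ` ?X = ?X" and x: "x \<in> V"
    have "f y \<in> S" if "y \<in> S" for y
      using that f by (cases "y \<in> ?X") blast+
    then have "f ` S = S"
      using S by (intro image_eq_self[OF f(1)]) auto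
    then show "f x = x" using assms f(1) x by (auto simp: asymmetric_set_def)
  qed
  show "\<exists>f\<in>F. f x \<notin> ?X" if "x \<in> V" for x
  proof (cases "\<exists>f\<in>F. f x \<notin> S")
    case False
    then show ?thesis by (intro bexI[OF _ id_mem]) auto
  qed auto
qed

text \<open>Once \<open>S\<close> forces a symmetry to fix \<open>W\<close> pointwise, only the
  pointwise stabiliser of \<open>W\<close> remains to be broken on \<open>V - W\<close>.\<close>

lemma asymmetric_set_union:
  assumes "W \<subseteq> V" "\<And>f x. f \<in> F \<Longrightarrow> x \<in> W \<Longrightarrow> f x \<in> W"
    and S: "asymmetric_set F W S" and T: "asymmetric_set {f \<in> F. \<forall>x\<in>W. f x = x} (V - W) T"
  shows "asymmetric_set F V (S \<union> T)"
  unfolding asymmetric_set_def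
proof (intro conjI ballI impI)
  have ST: "S \<subseteq> W" "T \<subseteq> V - W" using S T by (auto simp: asymmetric_set_def)
  then show "S \<union> T \<subseteq> V" using assms(1) by auto
  fix f x assume f: "f \<in> F" "f ` (S \<union> T) = S \<union> T" and x: "x \<in> V"
  have fW: "f ` W = W"
    using assms(1,2) f(1) by (intro image_eq_self[OF f(1)]) auto
  have out: "f y \<notin> W" if "y \<in> V - W" for y
    using that fW image_mem_iff[OF f(1) assms(1)] by auto
  have "f ` S \<subseteq> S" "f ` T \<subseteq> T"
    using f(2) ST fW out by blast+
  then have "f ` S = S" "f ` T = T"
    using ST assms(1) by (auto intro!: image_eq_self[OF f(1)])
  then have "\<forall>x\<in>W. f x = x" "\<forall>x\<in>V - W. f x = x"
    using S T f(1) by (auto simp: asymmetric_set_def)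
  then show "f x = x" using x by blast
qed

section \<open>Orbitals and invariant digraphs\<close>

definition orbital :: "'a \<Rightarrow> 'a \<Rightarrow> ('a \<times> 'a) set" where
  "orbital x y = {(f x, f y) |f. f \<in> F}"

lemma orbital_refl: "(x, y) \<in> orbital x y"
  unfolding orbital_def using id_mem by (auto intro!: exI[of _ id])

lemma orbital_converse: "(orbital x y)\<inverse> = orbital y x"
  by (auto simp: orbital_def)

definition invariant :: "('a \<times> 'a) set \<Rightarrow> bool" where
  "invariant r \<longleftrightarrow> r \<subseteq> V \<times> V \<and> (\<forall>f\<in>F. \<forall>(x, y)\<in>r. (f x, f y) \<in> r)"

lemma invariant_orbital: "x \<in> V \<Longrightarrow> y \<in> V \<Longrightarrow> invariant (orbital x y)"
  unfolding invariant_def orbital_def using closed comp_mem by (fastforce simp: comp_def)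

lemma invariant_converse: "invariant r \<Longrightarrow> invariant (r\<inverse>)"
  by (auto simp: invariant_def)

lemma invariant_iff:
  assumes "invariant r" "f \<in> F" "x \<in> V" "y \<in> V"
  shows "(f x, f y) \<in> r \<longleftrightarrow> (x, y) \<in> r"
proof -
  obtain g where "g \<in> F" "g (f x) = x" "g (f y) = y" by (metis assms(2-4) inverse)
  then show ?thesis using assms unfolding invariant_def by (metis case_prodD)
qed

lemma invariant_Image_subset: "invariant r \<Longrightarrow> r `` A \<subseteq> V"
  by (auto simp: invariant_def)

lemma invariant_Image:
  assumes "invariant r" "f \<in> F" "A \<subseteq> V"
  shows "r `` (f ` A) = f ` (r `` A)"
proof
  show "f ` (r `` A) \<subseteq> r `` (f ` A)"
    using assms by (fastforce simp: invariant_def)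
  show "r `` (f ` A) \<subseteq> f ` (r `` A)"
  proof
    fix y assume "y \<in> r `` (f ` A)"
    then obtain a where a: "a \<in> A" "(f a, y) \<in> r" by auto
    then have "y \<in> V" using assms(1) by (auto simp: invariant_def)
    then obtain z where z: "z \<in> V" "y = f z" using image_V[OF assms(2)] by auto
    then have "(a, z) \<in> r" using a assms invariant_iff by blast
    then show "y \<in> f ` (r `` A)" using a z by auto
  qed
qed

lemma card_image_subset_V: "f \<in> F \<Longrightarrow> A \<subseteq> V \<Longrightarrow> card (f ` A) = card A"
  by (meson card_image inj_on_V inj_on_subset)

lemma orbital_arc_transitive:
  assumes "x \<in> V" "y \<in> V" "(a, b) \<in> orbital x y" "(c, d) \<in> orbital x y"
  obtains f where "f \<in> F" "f a = c" "f b = d"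
proof -
  obtain g h where g: "g \<in> F" "a = g x" "b = g y" and h: "h \<in> F" "c = h x" "d = h y"
    using assms(3,4) by (auto simp: orbital_def)
  obtain g' where "g' \<in> F" "g' a = x" "g' b = y" by (metis g assms(1,2) inverse)
  then show thesis using that[of "h \<circ> g'"] h comp_mem by auto
qed

text \<open>A map taking an arc to its reverse would swap two distinct vertices, against
  \<open>no_swap\<close>.\<close>

lemma orbital_antisym:
  assumes "x \<in> V" "y \<in> V" "x \<noteq> y" "(a, b) \<in> orbital x y"
  shows "(b, a) \<notin> orbital x y"
proof
  assume "(b, a) \<in> orbital x y"
  then obtain f where f: "f \<in> F" "f a = b" "f b = a"
    using orbital_arc_transitive assms by metis
  have "a \<in> V" using assms closed by (auto simp: orbital_def)
  then have "a = b" using no_swap f by blast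
  moreover obtain g where "g \<in> F" "a = g x" "b = g y" using assms(4) by (auto simp: orbital_def)
  ultimately show False using assms inj_on_V by (metis inj_onD)
qed

text \<open>The out-neighbours of \<open>a\<close> span a regular oriented graph, whose outdegree is less than
  half of its order.\<close>

lemma common_out_neighbours:
  assumes xy: "x \<in> V" "y \<in> V" "x \<noteq> y" and ab: "(a, b) \<in> orbital x y"
  shows "2 * card (orbital x y `` {a} \<inter> orbital x y `` {b}) < card (orbital x y `` {a})"
proof -
  let ?E = "orbital x y" and ?N = "orbital x y `` {a}"
  define c where "c = card (?N \<inter> ?E `` {b})"
  have inv: "invariant ?E" using xy invariant_orbital by blast
  have fin: "finite ?N" using invariant_Image_subset[OF inv] finite_V finite_subset by blast
  have aV: "a \<in> V" and bV: "b \<in> V" using ab inv by (auto simp: invariant_def)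
  \<comment> \<open>The stabiliser of \<open>a\<close> is transitive on \<open>?N\<close>, so all
    vertices of \<open>?N\<close> have the same number of out-neighbours inside
    \<open>?N\<close>.\<close>
  have const: "card (?N \<inter> ?E `` {z}) = c" if z: "z \<in> ?N" for z
  proof -
    obtain f where f: "f \<in> F" "f a = a" "f b = z"
      using orbital_arc_transitive[OF xy(1,2) ab] z by blast
    have "?N \<inter> ?E `` {z} = f ` (?E `` {a}) \<inter> f ` (?E `` {b})"
      using invariant_Image[OF inv f(1), of "{a}"] invariant_Image[OF inv f(1), of "{b}"] f aV bV
      by simp
    also have "\<dots> = f ` (?N \<inter> ?E `` {b})"
      using inj_on_image_Int[OF inj_on_V[OF f(1)]] invariant_Image_subset[OF inv] by blast
    finally show ?thesis
      using card_image_subset_V[OF f(1)] invariant_Image_subset[OF inv] c_def by (metis inf.coboundedI1)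
  qed
  let ?P = "Sigma ?N (\<lambda>z. ?N \<inter> ?E `` {z})"
  have cardP: "card ?P = card ?N * c"
    using fin const by (simp add: card_SigmaI)
  \<comment> \<open>\<open>?P\<close> is the set of arcs inside \<open>?N\<close>. With its reversal
    it fits into the off-diagonal pairs, whence \<open>2 * c < card ?N\<close>.\<close>
  have PQ: "?P \<inter> ?P\<inverse> = {}" "?P \<union> ?P\<inverse> \<subseteq> ?N \<times> ?N - Id"
    using orbital_antisym[OF xy] by blast+
  have finP: "finite ?P" using fin by auto
  have "2 * card ?P = card (?P \<union> ?P\<inverse>)"
    using PQ(1) finP by (simp add: card_Un_disjoint)
  also have "\<dots> \<le> card (?N \<times> ?N - Id)"
    using PQ(2) fin by (intro card_mono) auto
  also have "\<dots> = card (?N \<times> ?N) - card (Id_on ?N)"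
    using fin by (subst card_Diff_subset[symmetric]) (auto simp: Id_on_def intro!: arg_cong[where f=card])
  also have "card (Id_on ?N) = card ?N"
    by (simp add: Id_on_def card_UN_disjoint fin)
  finally have "2 * (card ?N * c) \<le> card ?N * card ?N - card ?N"
    using cardP by (simp add: card_cartesian_product)
  moreover have "card ?N > 0" using ab fin by (auto simp: card_gt_0_iff)
  ultimately have "card ?N * (2 * c) < card ?N * card ?N"
    by (metis (no_types, lifting) diff_less le_less_trans mult.left_commute mult_pos_pos)
  then show ?thesis by (simp add: c_def)
qed

end

section \<open>Primitive actions\<close>

text \<open>A vertex in one of the boundaries on the left lies in a boundary on the right, and a
  vertex in both on the left lies in both on the right.\<close>

lemma boundary_submodular:
  assumes "finite (r `` A)" "finite (r `` B)"
  shows "card (r `` (A \<inter> B) - A \<inter> B) + card (r `` (A \<union> B) - (A \<union> B))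
    \<le> card (r `` A - A) + card (r `` B - B)"
proof -
  let ?P = "r `` A - A" and ?Q = "r `` B - B"
  let ?I = "r `` (A \<inter> B) - A \<inter> B" and ?J = "r `` (A \<union> B) - (A \<union> B)"
  have fin: "finite ?P" "finite ?Q" using assms by auto
  have sub: "?I \<union> ?J \<subseteq> ?P \<union> ?Q" "?I \<inter> ?J \<subseteq> ?P \<inter> ?Q" by auto
  have finIJ: "finite ?I" "finite ?J"
    using fin sub(1) by (meson finite_Un finite_subset)+
  have "card ?I + card ?J = card (?I \<union> ?J) + card (?I \<inter> ?J)"
    using finIJ by (rule card_Un_Int)
  also have "\<dots> \<le> card (?P \<union> ?Q) + card (?P \<inter> ?Q)"
    using fin sub by (intro add_mono card_mono) auto
  also have "\<dots> = card ?P + card ?Q"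
    using fin by (rule card_Un_Int[symmetric])
  finally show ?thesis .
qed

locale primitive_odd_action = odd_action +
  assumes transitive: "x \<in> V \<Longrightarrow> y \<in> V \<Longrightarrow> \<exists>f\<in>F. f x = y"
    and primitive: "A \<subseteq> V \<Longrightarrow> A \<noteq> {} \<Longrightarrow> (\<And>f. f \<in> F \<Longrightarrow> f ` A \<inter> A \<noteq> {} \<Longrightarrow> f ` A = A)
      \<Longrightarrow> A = V \<or> (\<exists>a. A = {a})"
begin

text \<open>A smallest set of minimum boundary is a block, by submodularity; by primitivity it is a
  single vertex. Reversing the arcs exchanges such a set with its complement, so taking the
  minimum over both directions ensures that the complement is not smaller.\<close>

lemma boundary_card:
  assumes inv: "invariant r" and irr: "irrefl r"
    and deg: "\<And>a. a \<in> V \<Longrightarrow> d \<le> card (r `` {a})" "\<And>a. a \<in> V \<Longrightarrow> d \<le> card (r\<inverse> `` {a})"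
    and Y: "Y \<subseteq> V" "Y \<noteq> {}" "Y \<union> r `` Y \<noteq> V"
  shows "d \<le> card (r `` Y - Y)"
proof (rule ccontr)
  assume less: "\<not> d \<le> card (r `` Y - Y)"
  \<comment> \<open>Counterexamples for \<open>r\<close> and for its converse compete;
    \<open>R\<close> compares boundaries first and then the sizes of the sets.\<close>
  define valid where "valid = (\<lambda>(s, A). (s = r \<or> s = r\<inverse>) \<and> A \<subseteq> V \<and> A \<noteq> {} \<and> A \<union> s `` A \<noteq> V
    \<and> card (s `` A - A) < d)"
  define R where "R = inv_image (less_than <*lex*> less_than)
    (\<lambda>(s :: ('a \<times> 'a) set, A). (card (s `` A - A), card A))"
  have "wf R" unfolding R_def by auto
  moreover have "(r, Y) \<in> Collect valid" using Y less by (auto simp: valid_def)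
  ultimately obtain p where p: "p \<in> Collect valid"
    and p_min: "\<And>q. (q, p) \<in> R \<Longrightarrow> q \<notin> Collect valid"
    by (rule wfE_min) blast
  obtain s A where sA: "p = (s, A)" by (cases p)
  define k where "k = card (s `` A - A)"
  have s: "s = r \<or> s = r\<inverse>" and A: "A \<subseteq> V" "A \<noteq> {}" "A \<union> s `` A \<noteq> V" and kd: "k < d"
    using p by (auto simp: sA valid_def k_def)
  have minimal: "k < card (s' `` B - B) \<or> k = card (s' `` B - B) \<and> card A \<le> card B"
    if "s' = r \<or> s' = r\<inverse>" "B \<subseteq> V" "B \<noteq> {}" "B \<union> s' `` B \<noteq> V" for s' B
  proof (rule ccontr)
    assume *: "\<not> ?thesis"
    then have "((s', B), p) \<in> R"
      by (auto simp: sA k_def R_def)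
    then have "(s', B) \<notin> Collect valid" by (rule p_min)
    then show False using that * kd by (auto simp: valid_def)
  qed
  have inv_s: "invariant s" using s inv invariant_converse by blast
  have sub: "s `` B \<subseteq> V" for B using inv_s by (rule invariant_Image_subset)
  have fin: "finite B" if "B \<subseteq> V" for B using that finite_V finite_subset by blast
  let ?C = "V - (A \<union> s `` A)"
  have "card A \<le> card ?C"
  proof -
    \<comment> \<open>A vertex with an arc into \<open>?C\<close> is not in \<open>A\<close>, as no
      vertex of \<open>?C\<close> is an out-neighbour of \<open>A\<close>. So \<open>?C\<close>
      competes with \<open>A\<close> in the reversed direction, with boundary at most
      \<open>k\<close>.\<close>
    have "s\<inverse> `` ?C - ?C \<subseteq> s `` A - A"
      using inv_s by (auto simp: invariant_def)
    then have "card (s\<inverse> `` ?C - ?C) \<le> k"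
      unfolding k_def using fin sub by (intro card_mono) blast+
    moreover have "?C \<noteq> {}" using A sub[of A] by blast
    moreover have "?C \<union> s\<inverse> `` ?C \<noteq> V" using A by blast
    ultimately show ?thesis
      using minimal[of "s\<inverse>" ?C] s by auto
  qed
  moreover have "card V = card (A \<union> s `` A) + card ?C"
    using A sub[of A] fin by (metis Un_least card_Diff_subset card_mono finite_V le_add_diff_inverse)
  moreover have "card (A \<union> s `` A) = card A + k"
    using card_Un_disjoint[of A "s `` A - A"] A sub[of A] fin by (simp add: k_def)
  ultimately have V_large: "2 * card A + k \<le> card V" by simp
  have block: "f ` A = A" if f: "f \<in> F" and meet: "f ` A \<inter> A \<noteq> {}" for f
  proof -
    let ?B = "f ` A"
    have BV: "?B \<subseteq> V" using A closed f by blast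
    have cardB: "card ?B = card A" using A(1) f by (rule card_image_subset_V[rotated])
    have "s `` ?B - ?B = f ` (s `` A - A)"
      using invariant_Image[OF inv_s f A(1)] inj_on_image_set_diff[OF inj_on_V[OF f], of "s `` A" A]
        sub A by auto
    then have kB: "card (s `` ?B - ?B) = k"
      using card_image_subset_V[OF f] sub by (metis Diff_subset k_def subset_trans)
    have submod: "card (s `` (A \<inter> ?B) - A \<inter> ?B) + card (s `` (A \<union> ?B) - (A \<union> ?B)) \<le> 2 * k"
      using boundary_submodular[of s A ?B] fin sub kB k_def by simp
    have I: "A \<inter> ?B \<noteq> {}" "(A \<inter> ?B) \<union> s `` (A \<inter> ?B) \<noteq> V"
      using meet A sub[of A] by blast+
    have kI: "k \<le> card (s `` (A \<inter> ?B) - A \<inter> ?B)"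
      using minimal[OF s _ I] A by force
    \<comment> \<open>The union has at most \<open>2 * card A - 1\<close> vertices and boundary at
      most \<open>k\<close>, too few to cover \<open>V\<close>.\<close>
    have "A \<union> ?B \<union> s `` (A \<union> ?B) \<noteq> V"
    proof
      assume eq: "A \<union> ?B \<union> s `` (A \<union> ?B) = V"
      have "card V \<le> card (A \<union> ?B) + card (s `` (A \<union> ?B) - (A \<union> ?B))"
        by (metis Un_Diff_cancel card_Un_le eq)
      moreover have "card (A \<union> ?B) + card (A \<inter> ?B) = 2 * card A"
        using card_Un_Int[of A ?B] fin A BV cardB by simp
      moreover have "card (A \<inter> ?B) > 0" using I fin A by (simp add: card_gt_0_iff)
      ultimately show False using V_large submod kI by linarith
    qed
    then have "k \<le> card (s `` (A \<union> ?B) - (A \<union> ?B))"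
      using minimal[OF s, of "A \<union> ?B"] A BV by force
    \<comment> \<open>The intersection attains the least boundary, so the second component of the
      order forbids it to be smaller than \<open>A\<close>.\<close>
    then have "card (s `` (A \<inter> ?B) - A \<inter> ?B) = k" using submod kI by linarith
    then have "card A \<le> card (A \<inter> ?B)"
      using minimal[OF s _ I] A by force
    then have "A \<inter> ?B = A"
      using A fin by (intro card_seteq) auto
    then show "?B = A"
      using cardB fin BV by (metis card_subset_eq inf.absorb_iff1)
  qed
  consider "A = V" | a where "A = {a}" using primitive[OF A(1,2) block] by blast
  then show False
  proof cases
    case 1
    then show False using A sub by blast
  next
    case 2
    then have "a \<in> V" "s `` A - A = s `` {a}" using s irr A by (auto simp: irrefl_def)
    moreover have "d \<le> card (s `` {a})" using s deg[OF \<open>a \<in> V\<close>] by auto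
    ultimately show False using kd by (simp add: k_def)
  qed
qed

end

section \<open>The digraph of a nontrivial orbital of least outdegree\<close>

locale minimal_orbital = primitive_odd_action +
  fixes E :: "('a \<times> 'a) set" and d :: nat
  assumes orbital_E: "\<exists>x\<in>V. \<exists>y\<in>V. x \<noteq> y \<and> E = orbital x y"
    and outdegree: "v \<in> V \<Longrightarrow> card (E `` {v}) = d"
    and minimal: "x \<in> V \<Longrightarrow> y \<in> V \<Longrightarrow> x \<noteq> y \<Longrightarrow> d \<le> card (orbital x y `` {x})"
begin

lemma inv_E: "invariant E"
  using orbital_E invariant_orbital by auto

lemma E_subset: "E \<subseteq> V \<times> V"
  using inv_E by (simp add: invariant_def)

lemma finite_E_Image: "finite (E `` A)" "finite (E\<inverse> `` A)"
  using E_subset finite_V by (auto intro: finite_subset[of _ V])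

lemma antisym_E: "(a, b) \<in> E \<Longrightarrow> (b, a) \<notin> E"
  using orbital_E orbital_antisym by blast

lemma irrefl_E: "(a, a) \<notin> E"
  using antisym_E by blast

lemma in_neighbour:
  assumes "v \<in> V"
  obtains z where "(z, v) \<in> E"
proof -
  obtain x y where xy: "x \<in> V" "y \<in> V" "(x, y) \<in> E" using orbital_E orbital_refl by blast
  then obtain f where f: "f \<in> F" "f y = v" using transitive assms by blast
  then have "(f x, v) \<in> E" using xy(3) inv_E unfolding invariant_def by blast
  then show thesis by (rule that)
qed

text \<open>The converse of an orbital is an orbital too, so the minimality of \<open>d\<close> also
  bounds indegrees.\<close>

lemma indegree:
  assumes "v \<in> V"
  shows "d \<le> card (E\<inverse> `` {v})"
proof -
  obtain x y where xy: "x \<in> V" "y \<in> V" "x \<noteq> y" "E = orbital x y" using orbital_E by blast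
  obtain f where f: "f \<in> F" "f y = v" using transitive[OF xy(2) assms] by blast
  have "d \<le> card (E\<inverse> `` {y})" using minimal[of y x] xy by (simp add: orbital_converse)
  also have "\<dots> = card (f ` (E\<inverse> `` {y}))"
    using card_image_subset_V[OF f(1)] invariant_Image_subset[OF invariant_converse[OF inv_E]] by metis
  also have "f ` (E\<inverse> `` {y}) = E\<inverse> `` {v}"
    using invariant_Image[OF invariant_converse[OF inv_E] f(1), of "{y}"] xy f by simp
  finally show ?thesis .
qed

lemma in_boundary_card:
  assumes "Y \<subseteq> V" "Y \<noteq> {}" "Y \<union> E\<inverse> `` Y \<noteq> V"
  shows "d \<le> card (E\<inverse> `` Y - Y)"
  using assms indegree outdegree irrefl_E invariant_converse[OF inv_E]
  by (intro boundary_card) (auto simp: irrefl_def)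

text \<open>Vertices with equal out-neighbourhoods form blocks. A block equal to \<open>V\<close>
  would give an in-neighbour of \<open>v\<close> the same out-neighbours as \<open>v\<close>, and
  \<open>v\<close> would have a loop.\<close>

lemma out_neighbours_inj:
  assumes u: "u \<in> V" and v: "v \<in> V" and eq: "E `` {u} = E `` {v}"
  shows "u = v"
proof -
  let ?A = "{w \<in> V. E `` {w} = E `` {v}}"
  have "f ` ?A = ?A" if f: "f \<in> F" and meet: "f ` ?A \<inter> ?A \<noteq> {}" for f
  proof -
    have img: "E `` {f w} = f ` (E `` {w})" if "w \<in> V" for w
      using invariant_Image[OF inv_E f, of "{w}"] that by simp
    obtain w where "w \<in> V" "E `` {w} = E `` {v}" "E `` {f w} = E `` {v}" using meet by auto
    then have "f ` (E `` {v}) = E `` {v}" using img by simp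
    then have "E `` {f x} = E `` {v}" if "x \<in> ?A" for x using img[of x] that by simp
    then have "f ` ?A \<subseteq> ?A" using closed f by blast
    then show ?thesis using f by (intro image_eq_self) auto
  qed
  then consider "?A = V" | a where "?A = {a}" using primitive[of ?A] v by blast
  then show ?thesis
  proof cases
    case 1
    obtain w where w: "(w, v) \<in> E" using in_neighbour v .
    then have "w \<in> V" using E_subset by auto
    then have "E `` {w} = E `` {v}" using 1 by blast
    then show ?thesis using w irrefl_E by blast
  next
    case 2
    then show ?thesis using u v eq by (metis (mono_tags, lifting) mem_Collect_eq singletonD)
  qed
qed

text \<open>With \<open>D\<close> the orbital of \<open>(x, f x)\<close>, every vertex fixed by \<open>f\<close> in \<open>D `` {x}\<close> is a common
  out-neighbour of \<open>x\<close> and \<open>f x\<close>, and likewise for in-neighbours; hence \<open>f\<close> moves more than half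
  of either neighbourhood of \<open>x\<close>, in total more than \<open>d\<close> vertices.\<close>

lemma fixed_outside_neighbours:
  assumes f: "f \<in> F" and fixed: "\<And>x. x \<in> V - E `` {v} \<Longrightarrow> f x = x" and v: "v \<in> V" and x: "x \<in> V"
  shows "f x = x"
proof (rule ccontr)
  assume neq: "f x \<noteq> x"
  let ?D = "orbital x (f x)" and ?D' = "orbital (f x) x"
  let ?M = "{y \<in> V. f y \<noteq> y}"
  have fx: "f x \<in> V" using f x closed by blast
  have half: "card (orbital a b `` {x}) < 2 * card (orbital a b `` {x} \<inter> ?M) \<and> d \<le> card (orbital a b `` {x})"
    if ab: "a \<in> V" "b \<in> V" "a \<noteq> b" and deg: "d \<le> card (orbital a b `` {x})"
      and c: "2 * card (orbital a b `` {x} \<inter> orbital a b `` {f x}) < card (orbital a b `` {x})" for a b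
  proof -
    let ?N = "orbital a b `` {x}"
    have inv: "invariant (orbital a b)" using ab invariant_orbital by blast
    have fin: "finite (orbital a b `` A)" for A
      using invariant_Image_subset[OF inv] finite_V finite_subset by blast
    have "?N - ?M \<subseteq> ?N \<inter> orbital a b `` {f x}"
    proof
      fix y assume y: "y \<in> ?N - ?M"
      then have "f y = y" using invariant_Image_subset[OF inv] by blast
      moreover have "(f x, f y) \<in> orbital a b" using y f inv by (auto simp: invariant_def)
      ultimately show "y \<in> ?N \<inter> orbital a b `` {f x}" using y by auto
    qed
    then have "card (?N - ?M) \<le> card (?N \<inter> orbital a b `` {f x})"
      using fin by (intro card_mono) auto
    moreover have "card ?N = card (?N \<inter> ?M) + card (?N - ?M)"
      using fin by (simp add: card_Int_Diff)
    ultimately show ?thesis using c deg by linarith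
  qed
  have D: "card (?D `` {x}) < 2 * card (?D `` {x} \<inter> ?M) \<and> d \<le> card (?D `` {x})"
    using half[OF x fx] neq minimal[OF x fx] common_out_neighbours[OF x fx _ orbital_refl] by simp
  \<comment> \<open>\<open>common_out_neighbours\<close> counts relative to \<open>f x\<close>, the
    tail of the arc; \<open>f x\<close> and \<open>x\<close> have the same outdegree in
    \<open>?D'\<close>.\<close>
  have D': "card (?D' `` {x}) < 2 * card (?D' `` {x} \<inter> ?M) \<and> d \<le> card (?D' `` {x})"
  proof -
    have inv: "invariant ?D'" using fx x invariant_orbital by blast
    have "?D' `` {f x} = f ` (?D' `` {x})"
      using invariant_Image[OF inv f, of "{x}"] x by simp
    then have eq: "card (?D' `` {f x}) = card (?D' `` {x})"
      using card_image_subset_V[OF f] invariant_Image_subset[OF inv] by metis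
    show ?thesis
      using half[OF fx x] neq minimal[OF fx x] common_out_neighbours[OF fx x _ orbital_refl] eq
      by (simp add: Int_commute)
  qed
  have M: "?M \<subseteq> E `` {v}" using fixed by blast
  have "x \<notin> ?D `` {x}" "x \<notin> ?D' `` {x}" "?D `` {x} \<inter> ?D' `` {x} = {}"
    using orbital_antisym[OF x fx neq[symmetric]] by (auto simp flip: orbital_converse[of "f x" x])
  then have "card (?D `` {x} \<inter> ?M) + card (?D' `` {x} \<inter> ?M) = card ((?D `` {x} \<union> ?D' `` {x}) \<inter> ?M)"
    using finite_V by (subst card_Un_disjoint[symmetric]) (auto intro!: arg_cong[where f=card])
  also have "\<dots> \<le> card ?M"
    using finite_V by (intro card_mono) auto
  also have "\<dots> \<le> d"
    using M finite_E_Image outdegree[OF v] card_mono by metis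
  finally show False using D D' by linarith
qed

section \<open>Vertices that reach \<open>v\<close> without meeting its out-neighbours\<close>

definition avoiding :: "'a \<Rightarrow> ('a \<times> 'a) set" where
  "avoiding v = {(a, b) \<in> E. a \<notin> E `` {v} \<and> b \<notin> E `` {v}}"

text \<open>A vertex outside \<open>core v\<close> and outside the out-neighbourhood of
  \<open>v\<close> is separated from \<open>v\<close> by that out-neighbourhood.\<close>

definition core :: "'a \<Rightarrow> 'a set" where
  "core v = {w. (w, v) \<in> (avoiding v)\<^sup>*}"

lemma core_self: "v \<in> core v"
  by (simp add: core_def)

lemma core_subset:
  assumes "v \<in> V"
  shows "core v \<subseteq> V - E `` {v}"
proof
  fix w assume "w \<in> core v"
  then have "(w, v) \<in> (avoiding v)\<^sup>*" by (simp add: core_def)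
  then show "w \<in> V - E `` {v}"
    using assms irrefl_E E_subset
    by (cases rule: converse_rtranclE) (auto simp: avoiding_def)
qed

text \<open>Hence the in-boundary of \<open>core v\<close> consists of out-neighbours of
  \<open>v\<close>.\<close>

lemma core_step:
  assumes "v \<in> V" "(p, a) \<in> E" "a \<in> core v" "p \<notin> E `` {v}"
  shows "p \<in> core v"
proof -
  have "(p, a) \<in> avoiding v" using assms core_subset by (auto simp: avoiding_def)
  then show ?thesis using assms(3) by (auto simp: core_def intro: converse_rtrancl_into_rtrancl)
qed

text \<open>Path lengths are kept so that both \<open>core\<close> and \<open>rank\<close> inherit
  the symmetry.\<close>

lemma relpow_avoiding:
  assumes f: "f \<in> F" and v: "v \<in> V" and "(a, b) \<in> avoiding v ^^ k"
  shows "(f a, f b) \<in> avoiding (f v) ^^ k"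
  using assms(3)
proof (induction k arbitrary: b)
  case (Suc k)
  then obtain c where c: "(a, c) \<in> avoiding v ^^ k" "(c, b) \<in> avoiding v" by auto
  have "(f c, f b) \<in> avoiding (f v)"
    using c(2) f v E_subset by (auto simp: avoiding_def invariant_iff[OF inv_E])
  then show ?case using Suc.IH[OF c(1)] by auto
qed simp

lemma core_image:
  assumes f: "f \<in> F" and v: "v \<in> V"
  shows "core (f v) = f ` core v"
proof -
  have sub: "g ` core w \<subseteq> core (g w)" if "g \<in> F" "w \<in> V" for g w
    using relpow_avoiding[OF that] by (auto simp: core_def rtrancl_power)
  obtain g where g: "g \<in> F" "\<And>x. x \<in> V \<Longrightarrow> g (f x) = x" "\<And>x. x \<in> V \<Longrightarrow> f (g x) = x"
    using inverse[OF f] by blast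
  have "w \<in> f ` core v" if w: "w \<in> core (f v)" for w
  proof -
    have "w \<in> V" using w core_subset closed f v by blast
    moreover have "g w \<in> core v" using sub[OF g(1), of "f v"] w g(2)[OF v] closed f v by fastforce
    ultimately show ?thesis using g(3) by (metis image_eqI)
  qed
  then show ?thesis using sub[OF f v] by blast
qed

text \<open>The distance to \<open>v\<close> in \<open>avoiding v\<close>. Off \<open>core v\<close>
  no \<open>k\<close> qualifies and the value is unspecified, but maps fixing \<open>v\<close> still
  preserve it.\<close>

definition rank :: "'a \<Rightarrow> 'a \<Rightarrow> nat" where
  "rank v w = (LEAST k. (w, v) \<in> avoiding v ^^ k)"

lemma rank_image:
  assumes f: "f \<in> F" "f v = v" and v: "v \<in> V" and w: "w \<in> V"
  shows "rank v (f w) = rank v w"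
proof -
  obtain g where g: "g \<in> F" "g (f w) = w" "g v = v" by (metis f v w inverse)
  have "(f w, v) \<in> avoiding v ^^ k \<longleftrightarrow> (w, v) \<in> avoiding v ^^ k" for k
    using relpow_avoiding[OF f(1) v, of w v k] relpow_avoiding[OF g(1) v, of "f w" v k] f g by auto
  then show ?thesis by (simp add: rank_def)
qed

lemma rank_decreasing:
  assumes v: "v \<in> V" and w: "w \<in> core v" "w \<noteq> v"
  obtains z where "(w, z) \<in> E" "z \<in> core v" "rank v z < rank v w"
proof -
  have "\<exists>k. (w, v) \<in> avoiding v ^^ k" using w by (auto simp: core_def rtrancl_power)
  then have k: "(w, v) \<in> avoiding v ^^ rank v w" unfolding rank_def by (rule LeastI_ex)
  with w(2) obtain j where j: "rank v w = Suc j" by (cases "rank v w") auto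
  then obtain z where z: "(w, z) \<in> avoiding v" "(z, v) \<in> avoiding v ^^ j"
    using k relpow_Suc_D2 by metis
  have "rank v z \<le> j" unfolding rank_def using z(2) by (rule Least_le)
  then show thesis
    using that[of z] z j by (auto simp: avoiding_def core_def rtrancl_power)
qed

text \<open>Separation makes the cores of \<open>u\<close> and \<open>v\<close>, without these two
  vertices, disjoint; as all cores have the same size, they are small. But \<open>core v\<close>
  overlaps the core of an in-neighbour \<open>z\<close> of \<open>v\<close>, and counting boundaries
  shows that their union is too large.\<close>

lemma no_mutual_separation:
  assumes u: "u \<in> V" and v: "v \<in> V" and neq: "u \<noteq> v"
    and uv: "u \<notin> core v" "u \<notin> E `` {v}" and vu: "v \<notin> core u" "v \<notin> E `` {u}"
  shows False
proof -
  let ?N = "\<lambda>v. E `` {v}"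
  define A where "A = (\<lambda>v. core v - {v})"
  define C where "C = ?N u \<inter> ?N v"
  have fin: "finite X" if "X \<subseteq> V" for X using that finite_V finite_subset by blast
  have N: "?N w \<subseteq> V" for w using invariant_Image_subset[OF inv_E] .
  have core: "core w \<subseteq> V" "core w \<inter> ?N w = {}" if "w \<in> V" for w using core_subset[OF that] by auto
  have A_sub: "A w \<subseteq> V" if "w \<in> V" for w using core(1)[OF that] by (auto simp: A_def)
  have card_core: "card (core w) = Suc (card (A v))" if w: "w \<in> V" for w
  proof -
    obtain f where f: "f \<in> F" "f v = w" using transitive v w by blast
    have "card (core w) = card (core v)"
      using core_image[OF f(1) v] f card_image_subset_V[OF f(1) core(1)[OF v]] by simp
    then show ?thesis
      using card_Suc_Diff1[OF fin[OF core(1)[OF v]] core_self] by (simp only: A_def)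
  qed
  then have card_A: "card (A u) = card (A v)"
    using core_self[of u] fin[OF core(1)[OF u]] u by (simp add: A_def)
  \<comment> \<open>Deleting \<open>w\<close> from its core does not enlarge the in-boundary bound:
    arcs leaving \<open>w\<close> end in its out-neighbourhood, which is disjoint from the
    core.\<close>
  have pred: "p \<in> A w \<union> ?N w" if "w \<in> V" "(p, y) \<in> E" "y \<in> A w" for w p y
  proof (cases "p \<in> ?N w")
    case False
    then have "p \<in> core w" using core_step[OF that(1,2)] that(3) by (auto simp: A_def)
    moreover have "p \<noteq> w" using that core(2)[OF that(1)] by (auto simp: A_def)
    ultimately show ?thesis by (simp add: A_def)
  qed simp
  have A_N: "A v \<inter> ?N u = {}" "A u \<inter> ?N v = {}"
    using pred[OF v, of u] pred[OF u, of v] uv vu by (auto simp: A_def)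
  have "A u \<inter> A v = {}"
  proof (rule ccontr)
    assume nonempty: "A u \<inter> A v \<noteq> {}"
    \<comment> \<open>Distinct vertices have different out-neighbourhoods, each of size
      \<open>d\<close>.\<close>
    have "card C < d"
    proof (rule ccontr)
      assume "\<not> card C < d"
      then have "C = ?N w" if "w \<in> V" "C \<subseteq> ?N w" for w
        using that outdegree[OF that(1)] finite_E_Image(1)[of "{w}"] by (intro card_seteq) auto
      then have "C = ?N u" "C = ?N v" using u v by (simp_all add: C_def)
      then show False using out_neighbours_inj u v neq by metis
    qed
    \<comment> \<open>The in-boundary of the intersection is confined to \<open>C\<close>, too small
      for the bound of \<open>in_boundary_card\<close>.\<close>
    have sub: "E\<inverse> `` (A u \<inter> A v) - (A u \<inter> A v) \<subseteq> C"
      using pred[OF u] pred[OF v] A_N unfolding C_def by blast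
    then have "card (E\<inverse> `` (A u \<inter> A v) - (A u \<inter> A v)) \<le> card C"
      using finite_E_Image by (intro card_mono) (auto simp: C_def)
    moreover have "v \<notin> A u \<inter> A v \<union> E\<inverse> `` (A u \<inter> A v)"
      using sub vu(2) by (auto simp: A_def C_def)
    then have "A u \<inter> A v \<union> E\<inverse> `` (A u \<inter> A v) \<noteq> V" using v by metis
    then have "d \<le> card (E\<inverse> `` (A u \<inter> A v) - (A u \<inter> A v))"
      using nonempty A_sub[OF u] by (intro in_boundary_card) auto
    ultimately show False using \<open>card C < d\<close> by simp
  qed
  moreover have "A v \<inter> ?N v = {}" using core(2)[OF v] by (auto simp: A_def)
  ultimately have disj: "A u \<inter> (A v \<union> (?N v \<union> {u, v})) = {}" "A v \<inter> (?N v \<union> {u, v}) = {}"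
    "?N v \<inter> {u, v} = {}"
    using A_N uv vu irrefl_E by (auto simp: A_def)
  have "card (A u \<union> (A v \<union> (?N v \<union> {u, v}))) = card (A u) + (card (A v) + (card (?N v) + card {u, v}))"
    using disj fin[OF A_sub[OF u]] fin[OF A_sub[OF v]] finite_E_Image
    by (simp only: card_Un_disjoint finite_Un finite.intros simp_thms)
  moreover have "card (A u \<union> (A v \<union> (?N v \<union> {u, v}))) \<le> card V"
    using A_sub[OF u] A_sub[OF v] N u v finite_V by (intro card_mono) auto
  ultimately have V_large: "2 * card (A v) + d + 2 \<le> card V"
    using card_A outdegree[OF v] neq by simp
  \<comment> \<open>An in-neighbour of \<open>v\<close> belongs to both its own core and
    \<open>core v\<close>, so these two cores meet.\<close>
  obtain z where zv: "(z, v) \<in> E" using in_neighbour v .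
  then have z: "z \<in> V" "z \<notin> ?N v" using E_subset antisym_E by auto
  let ?I = "core z \<inter> core v" and ?J = "core z \<union> core v"
  let ?P = "E\<inverse> `` ?I - ?I" and ?Q = "E\<inverse> `` ?J - ?J"
  have z_I: "z \<in> ?I" using core_step[OF v zv core_self z(2)] core_self by simp
  have bd: "p \<in> core w \<union> ?N w" if "w \<in> V" "(p, a) \<in> E" "a \<in> core w" for p a w
    using core_step that by blast
  \<comment> \<open>Omitting \<open>v\<close>, an out-neighbour of \<open>z\<close>, is the saving
    that brings the two boundaries strictly below \<open>2 * d\<close> in total.\<close>
  have "?P \<union> ?Q \<subseteq> ?N v \<union> ?N z - {v}"
    using bd[OF z(1)] bd[OF v] core(2)[OF v] core_self by blast
  then have "card (?P \<union> ?Q) \<le> card (?N v \<union> ?N z - {v})"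
    using finite_E_Image by (intro card_mono) auto
  moreover have "card (?N v \<union> ?N z - {v}) < card (?N v \<union> ?N z)"
    using zv finite_E_Image by (intro card_Diff1_less) auto
  moreover have "?P \<inter> ?Q \<subseteq> ?N v \<inter> ?N z"
    using bd[OF z(1)] bd[OF v] by blast
  then have "card (?P \<inter> ?Q) \<le> card (?N v \<inter> ?N z)"
    using finite_E_Image by (intro card_mono) auto
  moreover have "card ?P + card ?Q = card (?P \<union> ?Q) + card (?P \<inter> ?Q)"
    using finite_E_Image by (intro card_Un_Int) auto
  moreover have "card (?N v) + card (?N z) = card (?N v \<union> ?N z) + card (?N v \<inter> ?N z)"
    using finite_E_Image by (intro card_Un_Int) auto
  ultimately have PQ: "card ?P + card ?Q < 2 * d" using outdegree v z by simp
  \<comment> \<open>Because of \<open>u\<close>, the set \<open>?I\<close> and its boundary do not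
    cover \<open>V\<close>, so \<open>?P\<close> takes up at least \<open>d\<close>. What remains
    for \<open>?Q\<close> is below \<open>d\<close>, which forces \<open>?J\<close> and its boundary
    to cover \<open>V\<close>.\<close>
  have "u \<notin> ?I \<union> E\<inverse> `` ?I" using bd[OF v] uv by blast
  then have "?I \<union> E\<inverse> `` ?I \<noteq> V" using u by metis
  then have "d \<le> card ?P" using z_I core(1)[OF v] by (intro in_boundary_card) auto
  with PQ have Q: "card ?Q < d" by simp
  then have "?J \<union> E\<inverse> `` ?J = V"
    using in_boundary_card[of ?J] z_I core(1)[OF v] core(1)[OF z(1)] by auto
  then have "card V \<le> card ?J + card ?Q"
    by (metis Un_Diff_cancel card_Un_le)
  moreover have "card (core z) + card (core v) = card ?J + card ?I"
    using fin core(1) v z(1) by (intro card_Un_Int) auto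
  moreover have "card ?I > 0"
    using z_I fin[OF core(1)[OF v]] by (auto simp: card_gt_0_iff)
  ultimately show False using V_large Q card_core[OF v] card_core[OF z(1)] by simp
qed

end

context minimal_orbital
begin

text \<open>The set consists of the out-neighbours of \<open>v\<close> and, for each rank \<open>t\<close>, of a set breaking the
  symmetries that fix \<open>v\<close> and every vertex of rank above \<open>t\<close>; as it contains none of their orbits,
  \<open>v\<close> is the only vertex of its core outside the set whose out-neighbours all lie in the set.\<close>

lemma ex_asymmetric_set:
  assumes IH: "\<forall>(K :: ('a \<Rightarrow> 'a) set) W. odd_action K W \<longrightarrow> card W < card V \<longrightarrow> (\<exists>X. asymmetric_set K W X)"
  shows "\<exists>S. asymmetric_set F V S"
proof -
  obtain v where v: "v \<in> V" using orbital_E by blast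
  let ?N = "E `` {v}"
  define W where "W = V - ?N - {v}"
  define level where "level = (\<lambda>t. {w \<in> W. rank v w = t})"
  define K where "K = (\<lambda>t. {f \<in> F. f v = v \<and> (\<forall>w\<in>W. t < rank v w \<longrightarrow> f w = w)})"
  have W_closed: "f w \<in> W" if f: "f \<in> F" "f v = v" and w: "w \<in> W" for f w
  proof -
    have "w \<in> V" using w by (simp add: W_def)
    moreover have "f w \<notin> ?N"
      using invariant_iff[OF inv_E f(1) v \<open>w \<in> V\<close>] f(2) w by (auto simp: W_def)
    moreover have "f w \<noteq> v"
      using inj_onD[OF inj_on_V[OF f(1)], of w v] f(2) v w by (auto simp: W_def)
    ultimately show ?thesis using closed[OF f(1)] by (simp add: W_def)
  qed
  have level_closed: "f w \<in> level t" if "f \<in> F" "f v = v" "w \<in> level t" for f w t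
    using that W_closed rank_image[OF _ _ v] by (auto simp: level_def W_def)
  have "\<exists>X. asymmetric_set (K t) (level t) X \<and> (\<forall>w\<in>level t. \<exists>f\<in>K t. f w \<notin> X)" for t
  proof -
    have action: "odd_action (K t) (level t)"
    proof (rule subaction)
      show "f \<circ> g \<in> K t" if "f \<in> K t" "g \<in> K t" for f g
        using that comp_mem by (auto simp: K_def)
      show "level t \<subseteq> V" by (auto simp: level_def W_def)
      show "f w \<in> level t" if "f \<in> K t" "w \<in> level t" for f w
        using that level_closed by (auto simp: K_def)
    qed (auto simp: K_def id_mem)
    have "card (level t) < card V"
      using v finite_V by (intro psubset_card_mono) (auto simp: level_def W_def)
    with action obtain X where "asymmetric_set (K t) (level t) X" using IH by blast
    then show ?thesis by (rule odd_action.asymmetric_set_no_orbit[OF action]) blast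
  qed
  then obtain X where X: "\<And>t. asymmetric_set (K t) (level t) (X t)"
    and no_orbit: "\<And>t w. w \<in> level t \<Longrightarrow> \<exists>f\<in>K t. f w \<notin> X t"
    by metis
  define S where "S = ?N \<union> (\<Union>t. X t)"
  have X_sub: "X t \<subseteq> level t" for t using X by (simp add: asymmetric_set_def)
  have S_level: "S \<inter> level t = X t" for t
    using X_sub by (fastforce simp: S_def level_def W_def)
  have S_V: "S \<subseteq> V" "v \<notin> S"
    using X_sub invariant_Image_subset[OF inv_E] irrefl_E by (fastforce simp: S_def level_def W_def)+
  have root: "w \<notin> core v" if w: "w \<in> V" "w \<notin> S" "E `` {w} \<subseteq> S" "w \<noteq> v" for w
  proof
    assume "w \<in> core v"
    then obtain z where z: "(w, z) \<in> E" "z \<in> core v" "rank v z < rank v w"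
      using rank_decreasing[OF v] w(4) by metis
    have wW: "w \<in> W" using w by (auto simp: W_def S_def)
    have "z \<in> S" using w(3) z(1) by blast
    then have "z \<in> level (rank v z)"
      using z core_subset[OF v] S_V by (auto simp: level_def W_def)
    \<comment> \<open>The orbit of \<open>z\<close> under \<open>K (rank v z)\<close> leaves
      \<open>X\<close>, while \<open>w\<close>, of larger rank, stays fixed; so some out-neighbour
      of \<open>w\<close> is missing from \<open>S\<close>.\<close>
    then obtain f where f: "f \<in> K (rank v z)" "f z \<notin> X (rank v z)" using no_orbit by blast
    then have "f w = w" using wW z(3) by (auto simp: K_def)
    then have "(w, f z) \<in> E" using z(1) f(1) inv_E by (fastforce simp: K_def invariant_def)
    then have "f z \<in> S" using w(3) by blast
    moreover have "f z \<in> level (rank v z)"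
      using level_closed f(1) \<open>z \<in> level (rank v z)\<close> by (auto simp: K_def)
    ultimately show False using S_level f(2) by blast
  qed
  have "f x = x" if f: "f \<in> F" "f ` S = S" and x: "x \<in> V" for f x
  proof -
    have fv: "f v = v"
    proof (rule ccontr)
      assume neq: "f v \<noteq> v"
      \<comment> \<open>Like \<open>v\<close>, the vertex \<open>u\<close> lies outside
        \<open>S\<close> with all its out-neighbours in \<open>S\<close>, so \<open>root\<close>
        puts it outside \<open>core v\<close>. Applied to \<open>g v\<close>, \<open>root\<close>
        puts \<open>v\<close> outside \<open>core u\<close>, and the two vertices separate each
        other.\<close>
      define u where "u = f v"
      obtain g where g: "g \<in> F" "\<And>x. x \<in> V \<Longrightarrow> g (f x) = x" "\<And>x. x \<in> V \<Longrightarrow> f (g x) = x"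
        using inverse[OF f(1)] by blast
      have u: "u \<in> V" "u \<notin> S" "E `` {u} \<subseteq> S"
      proof -
        show "u \<in> V" using f(1) v closed by (simp add: u_def)
        show "u \<notin> S" using image_mem_iff[OF f(1) S_V(1) v] f(2) S_V(2) by (simp add: u_def)
        have "E `` {u} = f ` ?N" using invariant_Image[OF inv_E f(1), of "{v}"] v by (simp add: u_def)
        also have "\<dots> \<subseteq> f ` S" by (auto simp: S_def)
        finally show "E `` {u} \<subseteq> S" using f(2) by simp
      qed
      have w: "g v \<in> V" "f (g v) = v"
        using g v closed by auto
      have "v \<notin> core u"
      proof
        assume "v \<in> core u"
        then have "g v \<in> core v"
          using core_image[OF f(1) v] core_subset[OF v] g(2) by (fastforce simp: u_def)
        moreover have "g v \<noteq> v" using w neq by metis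
        moreover have "g v \<notin> S" using image_mem_iff[OF f(1) S_V(1) w(1)] w(2) f(2) S_V(2) by simp
        moreover have "E `` {g v} \<subseteq> S"
        proof -
          have "f ` (E `` {g v}) = ?N" using invariant_Image[OF inv_E f(1), of "{g v}"] w by simp
          then have "f ` (E `` {g v}) \<subseteq> f ` S" using f(2) by (simp add: S_def)
          then show ?thesis
            using image_mem_iff[OF f(1) S_V(1)] invariant_Image_subset[OF inv_E] by blast
        qed
        ultimately show False using root w(1) by blast
      qed
      moreover have "v \<notin> E `` {u}" using u(3) S_V(2) by blast
      moreover have "u \<notin> core v" using root u neq by (simp add: u_def)
      moreover have "u \<notin> ?N" using u(2) by (simp add: S_def)
      ultimately show False using no_mutual_separation u(1) v neq u_def by blast
    qed
    have fW: "f w = w" if "w \<in> W" for w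
    proof (rule ccontr)
      assume "f w \<noteq> w"
      let ?M = "{w \<in> W. f w \<noteq> w}"
      have finM: "finite ?M" using finite_V by (simp add: W_def)
      \<comment> \<open>A moved vertex of highest rank puts \<open>f\<close> into the group
        \<open>K\<close> of its level, whose action there is broken by \<open>X\<close>.\<close>
      have "Max (rank v ` ?M) \<in> rank v ` ?M" using finM that \<open>f w \<noteq> w\<close> by (intro Max_in) auto
      then obtain t where t: "t \<in> ?M" "rank v t = Max (rank v ` ?M)" by auto
      have "\<forall>w\<in>W. rank v t < rank v w \<longrightarrow> f w = w"
        using t(2) finM by (metis (mono_tags, lifting) Max_ge finite_imageI image_eqI leD mem_Collect_eq)
      then have fK: "f \<in> K (rank v t)" using f(1) fv by (simp add: K_def)
      have "f ` X (rank v t) \<subseteq> X (rank v t)"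
        using level_closed[OF f(1) fv] f(2) S_level by blast
      then have "f ` X (rank v t) = X (rank v t)"
        using X_sub[of "rank v t"] by (intro image_eq_self[OF f(1)]) (auto simp: level_def W_def)
      then show False using X[of "rank v t"] fK t(1) by (auto simp: asymmetric_set_def level_def)
    qed
    show "f x = x"
      using fixed_outside_neighbours[OF f(1) _ v x] fW fv by (auto simp: W_def)
  qed
  then show ?thesis using S_V(1) unfolding asymmetric_set_def by blast
qed

end

section \<open>Intransitive and imprimitive actions\<close>

context odd_action
begin

text \<open>The orbit of \<open>x\<close> is a proper subset, as it misses \<open>y\<close>; it and
  its complement are broken in turn.\<close>

lemma ex_asymmetric_set_intransitive:
  assumes xy: "x \<in> V" "y \<in> V" "\<forall>f\<in>F. f x \<noteq> y"
    and IH: "\<forall>(K :: ('a \<Rightarrow> 'a) set) W. odd_action K W \<longrightarrow> card W < card V \<longrightarrow> (\<exists>X. asymmetric_set K W X)"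
  shows "\<exists>S. asymmetric_set F V S"
proof -
  define W where "W = (\<lambda>f. f x) ` F"
  define K where "K = {f \<in> F. \<forall>x\<in>W. f x = x}"
  have WV: "W \<subseteq> V" using closed xy(1) by (auto simp: W_def)
  have W_closed: "f w \<in> W" if f: "f \<in> F" and w: "w \<in> W" for f w
  proof -
    obtain g where g: "g \<in> F" "w = g x" using w by (auto simp: W_def)
    then have "f w = (f \<circ> g) x" by simp
    then show ?thesis using comp_mem[OF f g(1)] unfolding W_def by blast
  qed
  have "x \<in> W" using imageI[OF id_mem, of "\<lambda>f. f x"] by (simp add: W_def)
  moreover have "y \<notin> W" using xy(3) by (auto simp: W_def)
  ultimately have small: "card W < card V" "card (V - W) < card V"
    using xy WV finite_V by (auto intro!: psubset_card_mono)
  have "odd_action F W" using W_closed WV id_mem comp_mem by (intro subaction) auto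
  then obtain S where S: "asymmetric_set F W S" using IH small(1) by blast
  have "odd_action K (V - W)"
  proof (rule subaction)
    show "f w \<in> V - W" if "f \<in> K" "w \<in> V - W" for f w
    proof -
      have f: "f \<in> F" "f ` W = W" using that(1) image_eq_self[of f W] WV W_closed by (auto simp: K_def)
      then show ?thesis using image_mem_iff[OF f(1) WV, of w] that(2) closed by auto
    qed
  qed (auto simp: K_def id_mem comp_mem)
  then obtain T where "asymmetric_set K (V - W) T" using IH small(2) by blast
  then show ?thesis using asymmetric_set_union[OF WV _ S, of T] W_closed unfolding K_def by blast
qed

text \<open>In each block, \<open>X\<close> or its complement \<open>A - X\<close> encodes one bit: no symmetry of the block
  exchanges the two, as its square would be trivial.\<close>

lemma ex_asymmetric_set_imprimitive:
  assumes transitive: "\<forall>x\<in>V. \<forall>y\<in>V. \<exists>f\<in>F. f x = y"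
    and A: "A \<subseteq> V" "A \<noteq> V" "a \<in> A" "b \<in> A" "a \<noteq> b"
    and block: "\<forall>f\<in>F. f ` A \<inter> A \<noteq> {} \<longrightarrow> f ` A = A"
    and IH: "\<forall>(K :: ('a \<Rightarrow> 'a) set) W. odd_action K W \<longrightarrow> card W < card V \<longrightarrow> (\<exists>X. asymmetric_set K W X)"
  shows "\<exists>S. asymmetric_set F V S"
proof -
  have blocks: "f ` A = g ` A" if f: "f \<in> F" and g: "g \<in> F" and x: "x \<in> f ` A" "x \<in> g ` A" for f g x
  proof -
    obtain h where h: "h \<in> F" "\<And>x. x \<in> V \<Longrightarrow> h (g x) = x" "\<And>x. x \<in> V \<Longrightarrow> g (h x) = x"
      using inverse[OF g] by blast
    have "h x \<in> (h \<circ> f) ` A" using x(1) by auto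
    moreover have "h x \<in> A" using x(2) h(2) A(1) by auto
    ultimately have "(h \<circ> f) ` A = A" using block comp_mem[OF h(1) f] by blast
    then have "g ` A = (\<lambda>x. g (h x)) ` (f ` A)" by (metis image_comp image_image)
    also have "\<dots> = (\<lambda>x. x) ` (f ` A)"
      using h(3) closed[OF f] A(1) by (intro image_cong) auto
    finally show ?thesis by simp
  qed
  \<comment> \<open>\<open>B x\<close> identifies \<open>A\<close> with the block that contains
    \<open>x\<close>.\<close>
  define B where "B = (\<lambda>x. SOME f. f \<in> F \<and> x \<in> f ` A)"
  have B: "B x \<in> F \<and> x \<in> B x ` A" if x: "x \<in> V" for x
  proof -
    have "a \<in> V" using A by blast
    then obtain f where "f \<in> F" "f a = x" using transitive x by blast
    then have "f \<in> F \<and> x \<in> f ` A" using A(3) by auto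
    then show ?thesis unfolding B_def by (rule someI[of "\<lambda>f. f \<in> F \<and> x \<in> f ` A"])
  qed
  have BV: "B x ` A \<subseteq> V" if "x \<in> V" for x
    using B[OF that] closed A(1) by auto
  \<comment> \<open>Chosen from the block as a set, \<open>rep\<close> is constant on blocks.
    \<open>B\<close> need not be, which is why \<open>S\<close> below is built from
    \<open>B (rep x)\<close>.\<close>
  define rep where "rep = (\<lambda>x. SOME y. y \<in> B x ` A)"
  have rep: "rep x \<in> B x ` A" "rep x \<in> V" if "x \<in> V" for x
  proof -
    show "rep x \<in> B x ` A" unfolding rep_def using B[OF that] by (intro someI[of "\<lambda>y. y \<in> B x ` A" x]) simp
    then show "rep x \<in> V" using BV[OF that] by blast
  qed
  have rep_eq: "rep x = rep y" if "x \<in> V" "y \<in> B x ` A" for x y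
  proof -
    have "y \<in> V" using that(2) BV[OF that(1)] by blast
    then have "B x ` A = B y ` A" using blocks[of "B x" "B y" y] B that by blast
    then show ?thesis by (simp add: rep_def)
  qed
  define R where "R = rep ` V"
  have RV: "R \<subseteq> V" using rep by (auto simp: R_def)
  have rep_R: "rep r = r" if "r \<in> R" for r
    using that rep_eq[OF _ rep(1)] by (auto simp: R_def)
  have small: "card A < card V" "card R < card V"
  proof -
    show "card A < card V" using A finite_V by (intro psubset_card_mono) auto
    have "rep a = rep b"
    proof -
      have "B a ` A = A" using blocks[of "B a" id a] B[of a] A id_mem by auto
      then show ?thesis using rep_eq[of a b] A by auto
    qed
    then have "\<not> inj_on rep V" using A by (auto dest: inj_onD)
    then show "card R < card V"
      unfolding R_def using finite_V card_image_le eq_card_imp_inj_on le_neq_implies_less by metis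
  qed
  have f_B: "B (f x) ` A = f ` (B x ` A)" if f: "f \<in> F" and x: "x \<in> V" for f x
  proof -
    have "f x \<in> (f \<circ> B x) ` A"
      using imageI[of x "B x ` A" f] B[OF x] by (simp add: image_comp)
    then have "B (f x) ` A = (f \<circ> B x) ` A"
      using blocks[of "B (f x)" "f \<circ> B x" "f x"] B[OF x] B[of "f x"] closed[OF f x] comp_mem[OF f]
      by blast
    then show ?thesis by (simp add: image_comp)
  qed
  have f_rep: "rep (f (rep x)) = rep (f x)" if f: "f \<in> F" and x: "x \<in> V" for f x
    using rep_eq[of "f x" "f (rep x)"] imageI[OF rep(1)[OF x], of f] f_B[OF f x] closed[OF f x] by simp
  \<comment> \<open>\<open>hat f\<close> is the permutation of the blocks induced by
    \<open>f\<close>, read on representatives. Being the identity off \<open>R\<close>, it respects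
    \<open>id\<close> and composition on the whole type.\<close>
  define hat where "hat = (\<lambda>f x. if x \<in> R then rep (f x) else x)"
  have hat_mem: "hat f r \<in> R" if "f \<in> F" "r \<in> R" for f r
    using that RV closed by (auto simp: hat_def R_def)
  have hat_comp: "hat f \<circ> hat g = hat (f \<circ> g)" if "f \<in> F" "g \<in> F" for f g
  proof
    fix x
    show "(hat f \<circ> hat g) x = hat (f \<circ> g) x"
      using that hat_mem[of g x] f_rep[of f "g x"] RV closed by (auto simp: hat_def)
  qed
  have "odd_action (hat ` F) R"
  proof
    show "finite R" using finite_V by (simp add: R_def)
    have "hat id = id" using rep_R by (auto simp: hat_def)
    then show "id \<in> hat ` F" using id_mem by (metis imageI)
    show "f \<circ> g \<in> hat ` F" if "f \<in> hat ` F" "g \<in> hat ` F" for f g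
      using that hat_comp comp_mem by auto
    show "f x \<in> R" if "f \<in> hat ` F" "x \<in> R" for f x
      using that hat_mem by auto
    fix f' assume "f' \<in> hat ` F"
    then obtain f where f: "f \<in> F" "f' = hat f" by auto
    then obtain k where k: "odd k" "\<forall>x\<in>V. (f ^^ k) x = x" using odd_order by blast
    have "(hat f ^^ j) r = rep ((f ^^ j) r)" if "r \<in> R" for r j
    proof (induction j)
      case 0
      then show ?case using rep_R that by simp
    next
      case (Suc j)
      have "(f ^^ j) r \<in> V" using funpow_mem[OF f(1)] closed RV that by blast
      then show ?case
        using Suc f_rep[OF f(1), of "(f ^^ j) r"] by (auto simp: hat_def R_def)
    qed
    then show "\<exists>k. odd k \<and> (\<forall>x\<in>R. (f' ^^ k) x = x)"
      using k RV rep_R f(2) by (metis subsetD)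
  qed
  then obtain T where T: "asymmetric_set (hat ` F) R T" using IH small(2) by blast
  define K where "K = {f \<in> F. f ` A = A}"
  have K_comp: "f \<circ> g \<in> K" if "f \<in> K" "g \<in> K" for f g
    using that comp_mem image_comp[of f g A] by (simp add: K_def)
  then have "odd_action K A"
    using A(1) by (intro subaction) (auto simp: K_def id_mem)
  then obtain X where X: "asymmetric_set K A X" using IH small(1) by blast
  have XA: "X \<subseteq> A" using X by (simp add: asymmetric_set_def)
  have K_sub: "k ` X \<subseteq> A" if "k \<in> K" for k
    using image_mono[OF XA, of k] that by (simp add: K_def)
  have compl: "k ` (A - X) = A - k ` X" if "k \<in> K" for k
    using that inj_on_image_set_diff[of k V A X] inj_on_V XA A(1) by (auto simp: K_def)
  have no_flip: "k ` X \<noteq> A - X" if k: "k \<in> K" for k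
  proof
    assume eq: "k ` X = A - X"
    have "k ` (A - X) = X" using compl[OF k] eq XA by auto
    then have "(k \<circ> k) ` X = X" using eq image_comp[of k k X] by simp
    with K_comp[OF k k] have "k (k x) = x" if "x \<in> A" for x
      using X that unfolding asymmetric_set_def by (metis comp_apply)
    then have "k x = x" if "x \<in> A" for x
      using that no_swap[of k x "k x"] k A(1) by (auto simp: K_def)
    then have "k ` X = X" using XA by force
    then show False using eq XA A(3) by auto
  qed
  define Y where "Y = (\<lambda>r. if r \<in> T then X else A - X)"
  define S where "S = {x \<in> V. x \<in> B (rep x) ` Y (rep x)}"
  have S_block: "S \<inter> B r ` A = B r ` Y r" if r: "r \<in> R" for r
  proof -
    have rV: "r \<in> V" using r RV by auto
    have "rep x = r" "x \<in> V" if "x \<in> B r ` A" for x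
      using rep_eq[OF rV that] rep_R[OF r] BV[OF rV] that by auto
    then have "x \<in> S \<longleftrightarrow> x \<in> B r ` Y r" if "x \<in> B r ` A" for x
      using that by (simp add: S_def)
    moreover have "B r ` Y r \<subseteq> B r ` A" using XA by (auto simp: Y_def)
    ultimately show ?thesis by blast
  qed
  have "f x = x" if f: "f \<in> F" "f ` S = S" and x: "x \<in> V" for f x
  proof -
    \<comment> \<open>\<open>k\<close> is the action of \<open>f\<close> from the block of
      \<open>r\<close> to the image block, both identified with \<open>A\<close> through
      \<open>B\<close>.\<close>
    define move where "move = (\<lambda>r k. k \<in> K \<and> k ` Y r = Y (hat f r)
      \<and> (\<forall>z\<in>A. B (hat f r) (k z) = f (B r z)))"
    have ex_move: "\<exists>k. move r k" if r: "r \<in> R" for r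
    proof -
      let ?r = "hat f r"
      have rV: "r \<in> V" "?r \<in> V" "?r \<in> R" using r RV hat_mem f(1) by auto
      obtain h where h: "h \<in> F" "\<And>x. x \<in> V \<Longrightarrow> h (B ?r x) = x" "\<And>x. x \<in> V \<Longrightarrow> B ?r (h x) = x"
        using inverse[of "B ?r"] B[OF rV(2)] by blast
      have frV: "f r \<in> V" using closed f(1) rV by blast
      have "B ?r ` A = B (f r) ` A"
        using blocks[of "B ?r" "B (f r)" ?r] B rV frV rep(1)[OF frV] r by (simp add: hat_def)
      also have "\<dots> = f ` (B r ` A)" using f_B f(1) rV(1) .
      finally have img: "f ` (B r ` A) = B ?r ` A" by simp
      have BrA: "B r ` A \<subseteq> V" using BV rV(1) .
      have SV: "S \<subseteq> V" by (auto simp: S_def)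
      have "f ` (B r ` Y r) = f ` (S \<inter> B r ` A)" using S_block[OF r] by simp
      also have "\<dots> = f ` S \<inter> f ` (B r ` A)"
        using inj_on_image_Int[OF inj_on_V[OF f(1)] SV BrA] .
      also have "\<dots> = B ?r ` Y ?r" using f(2) img S_block[OF rV(3)] by simp
      finally have imgY: "f ` (B r ` Y r) = B ?r ` Y ?r" .
      have hB: "h ` (B ?r ` Z) = Z" if "Z \<subseteq> A" for Z
        using h(2) that A(1) by (force simp: image_image)
      let ?k = "h \<circ> (f \<circ> B r)"
      have kF: "?k \<in> F" using comp_mem h(1) f(1) B[OF rV(1)] by blast
      have "?k ` Z = h ` (f ` (B r ` Z))" for Z by (simp add: image_comp o_assoc)
      then have "?k ` A = A" "?k ` Y r = Y ?r"
        using img imgY hB XA by (auto simp: Y_def)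
      moreover have "B ?r (?k z) = f (B r z)" if "z \<in> A" for z
        using h(3) that BrA closed[OF f(1)] by auto
      ultimately have "move r ?k" using kF unfolding K_def move_def by blast
      then show ?thesis by blast
    qed
    \<comment> \<open>Differing bits would make \<open>k\<close> exchange \<open>X\<close> and its
      complement in \<open>A\<close>, which \<open>no_flip\<close> excludes.\<close>
    have T_iff: "hat f r \<in> T \<longleftrightarrow> r \<in> T" if r: "r \<in> R" for r
    proof -
      obtain k where k: "k \<in> K" "k ` Y r = Y (hat f r)" using ex_move[OF r] by (auto simp: move_def)
      have "A - (A - k ` X) = k ` X" using K_sub[OF k(1)] by blast
      then have "k ` X \<noteq> A - X" "k ` (A - X) \<noteq> X"
        using no_flip[OF k(1)] compl[OF k(1)] by auto
      then show ?thesis using k(2) by (auto simp: Y_def split: if_splits)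
    qed
    have TR: "T \<subseteq> R" using T by (simp add: asymmetric_set_def)
    have "hat f ` T = T"
      using odd_action.image_eq_self[OF \<open>odd_action (hat ` F) R\<close>, of "hat f" T] T_iff TR f(1) by blast
    then have hat_id: "hat f r = r" if "r \<in> R" for r
      using T that f(1) by (auto simp: asymmetric_set_def)
    define r where "r = rep x"
    have r: "r \<in> R" using x by (simp add: r_def R_def)
    obtain k where k: "k \<in> K" "k ` Y r = Y r" "\<And>z. z \<in> A \<Longrightarrow> B r (k z) = f (B r z)"
      using ex_move[OF r] hat_id[OF r] by (auto simp: move_def)
    have "k ` X = X"
    proof (cases "r \<in> T")
      case False
      then have "A - k ` X = A - X" using k(2) compl[OF k(1)] by (simp add: Y_def)
      then show ?thesis using double_diff[OF XA order_refl] double_diff[OF K_sub[OF k(1)] order_refl] by simp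
    qed (use k(2) in \<open>simp add: Y_def\<close>)
    then have "k z = z" if "z \<in> A" for z
      using X k(1) that by (auto simp: asymmetric_set_def)
    moreover have "x \<in> B r ` A"
    proof -
      have "B x ` A = B r ` A"
        using blocks[of "B x" "B r" r] B[OF x] rep[OF x] B[of r] by (simp add: r_def)
      then show ?thesis using B[OF x] by blast
    qed
    ultimately show "f x = x" using k(3) by auto
  qed
  then show ?thesis unfolding asymmetric_set_def by (intro exI[of _ S]) (auto simp: S_def)
qed

end

text \<open>The induction on \<open>card V\<close> generalises over \<open>F\<close> as well, since
  stabilisers and the action on blocks bring in new maps.\<close>

theorem odd_action_asymmetric_set:
  fixes F :: "('a \<Rightarrow> 'a) set"
  shows "odd_action F V \<Longrightarrow> \<exists>S. asymmetric_set F V S"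
proof (induction "card V" arbitrary: F V rule: less_induct)
  case less
  interpret odd_action F V by fact
  have IH: "\<forall>(K :: ('a \<Rightarrow> 'a) set) W. odd_action K W \<longrightarrow> card W < card V
      \<longrightarrow> (\<exists>X. asymmetric_set K W X)"
    using less.hyps by blast
  show ?case
  proof (cases "\<exists>x\<in>V. \<exists>y\<in>V. x \<noteq> y")
    case False
    then show ?thesis
      using closed by (intro exI[of _ "{}"]) (auto simp: asymmetric_set_def)
  next
    case nontrivial: True
    show ?thesis
    proof (cases "\<forall>x\<in>V. \<forall>y\<in>V. \<exists>f\<in>F. f x = y")
      case False
      then obtain x y where xy: "x \<in> V" "y \<in> V" "\<forall>f\<in>F. f x \<noteq> y" by blast
      show ?thesis by (rule ex_asymmetric_set_intransitive[OF xy IH])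
    next
      case transitive: True
      show ?thesis
      proof (cases "\<exists>A a b. A \<subseteq> V \<and> A \<noteq> V \<and> a \<in> A \<and> b \<in> A \<and> a \<noteq> b
          \<and> (\<forall>f\<in>F. f ` A \<inter> A \<noteq> {} \<longrightarrow> f ` A = A)")
        case True
        then obtain A a b where A: "A \<subseteq> V" "A \<noteq> V" "a \<in> A" "b \<in> A" "a \<noteq> b"
          "\<forall>f\<in>F. f ` A \<inter> A \<noteq> {} \<longrightarrow> f ` A = A"
          by blast
        show ?thesis by (rule ex_asymmetric_set_imprimitive[OF transitive A IH])
      next
        case False
        interpret primitive_odd_action F V
        proof
          show "A = V \<or> (\<exists>a. A = {a})" if "A \<subseteq> V" "A \<noteq> {}"
            "\<And>f. f \<in> F \<Longrightarrow> f ` A \<inter> A \<noteq> {} \<Longrightarrow> f ` A = A" for A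
          proof (rule ccontr)
            assume *: "\<not> ?thesis"
            then obtain a b where "a \<in> A" "b \<in> A" "a \<noteq> b"
              using \<open>A \<noteq> {}\<close> by blast
            moreover have "\<forall>f\<in>F. f ` A \<inter> A \<noteq> {} \<longrightarrow> f ` A = A" using that(3) by simp
            moreover have "A \<noteq> V" using * by simp
            ultimately show False using False that(1) by metis
          qed
        qed (use transitive in blast)
        let ?P = "{(x, y). x \<in> V \<and> y \<in> V \<and> x \<noteq> y}"
        let ?c = "\<lambda>(x, y). card (orbital x y `` {x})"
        obtain q where "q \<in> ?P" using nontrivial by blast
        then obtain p where p: "p \<in> ?P" "\<And>q. q \<in> ?P \<Longrightarrow> ?c p \<le> ?c q"
          using ex_has_least_nat[of "\<lambda>p. p \<in> ?P" q ?c] by blast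
        obtain x y where xy: "p = (x, y)" by (cases p)
        interpret minimal_orbital F V "orbital x y" "?c p"
        proof
          show "\<exists>a\<in>V. \<exists>b\<in>V. a \<noteq> b \<and> orbital x y = orbital a b" using p(1) xy by auto
          show "?c p \<le> card (orbital a b `` {a})" if "a \<in> V" "b \<in> V" "a \<noteq> b" for a b
            using p(2)[of "(a, b)"] that by simp
          fix v assume "v \<in> V"
          then obtain f where f: "f \<in> F" "f x = v" using transitive p(1) xy by auto
          have inv: "invariant (orbital x y)" using p(1) xy invariant_orbital by auto
          have "orbital x y `` {v} = f ` (orbital x y `` {x})"
            using invariant_Image[OF inv f(1), of "{x}"] f p(1) xy by simp
          then show "card (orbital x y `` {v}) = ?c p"
            using card_image_subset_V[OF f(1) invariant_Image_subset[OF inv]] xy by simp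
        qed
        show ?thesis by (rule ex_asymmetric_set[OF IH])
      qed
    qed
  qed
qed

section \<open>Tournaments\<close>

locale tournament =
  fixes H :: "'a pair_pre_digraph"
  assumes finite_verts: "finite (pverts H)"
    and arcs_subset: "parcs H \<subseteq> pverts H \<times> pverts H"
    and arc_iff: "u \<in> pverts H \<Longrightarrow> v \<in> pverts H \<Longrightarrow> (u, v) \<in> parcs H \<longleftrightarrow> u \<noteq> v \<and> (v, u) \<notin> parcs H"
begin

lemma arc_cases:
  assumes "u \<in> pverts H" "v \<in> pverts H" "u \<noteq> v"
  obtains "(u, v) \<in> parcs H" | "(v, u) \<in> parcs H"
  using assms arc_iff by blast

lemma no_loop: "(u, u) \<notin> parcs H"
  using arcs_subset arc_iff by blast

lemma no_reverse: "(u, v) \<in> parcs H \<Longrightarrow> (v, u) \<notin> parcs H"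
  using arcs_subset arc_iff by blast

lemma automorphism_arc: "automorphism H \<phi> \<Longrightarrow> (u, v) \<in> parcs H \<Longrightarrow> (\<phi> u, \<phi> v) \<in> parcs H"
  by (auto simp: automorphism_def)

lemma automorphism_mem: "automorphism H \<phi> \<Longrightarrow> u \<in> pverts H \<Longrightarrow> \<phi> u \<in> pverts H"
  by (simp add: automorphism_def permutes_in_image)

lemma automorphism_image: "automorphism H \<phi> \<Longrightarrow> \<phi> ` pverts H = pverts H"
  by (simp add: automorphism_def permutes_image)

lemma automorphism_eq_id:
  assumes "automorphism H \<phi>" "\<And>u. u \<in> pverts H \<Longrightarrow> \<phi> u = u"
  shows "\<phi> = id"
proof
  show "\<phi> u = id u" for u
    using assms by (cases "u \<in> pverts H") (auto simp: automorphism_def permutes_not_in)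
qed

lemma automorphism_id: "automorphism H id"
  by (auto simp: automorphism_def permutes_id)

lemma automorphism_comp: "automorphism H \<phi> \<Longrightarrow> automorphism H \<psi> \<Longrightarrow> automorphism H (\<phi> \<circ> \<psi>)"
  unfolding automorphism_def by (auto intro: permutes_compose)

lemma automorphism_funpow: "automorphism H \<phi> \<Longrightarrow> automorphism H (\<phi> ^^ k)"
  by (induction k) (auto simp: automorphism_id automorphism_comp)

text \<open>An involution would reverse the arc between a moved vertex and its image.\<close>

lemma involution_eq_id:
  assumes \<phi>: "automorphism H \<phi>" and inv: "\<And>u. \<phi> (\<phi> u) = u"
  shows "\<phi> = id"
proof (rule automorphism_eq_id[OF \<phi>], rule ccontr)
  fix u assume "u \<in> pverts H" "\<phi> u \<noteq> u"
  then show False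
    using arc_cases[of u "\<phi> u"] automorphism_mem[OF \<phi>] automorphism_arc[OF \<phi>] inv no_reverse by metis
qed

text \<open>If an even power of \<phi> is trivial, the power with half the exponent is an involution
  and hence trivial; halving ends at an odd exponent.\<close>

lemma automorphism_odd_order:
  assumes \<phi>: "automorphism H \<phi>"
  obtains k where "odd k" "\<phi> ^^ k = id"
proof -
  have "\<exists>k. odd k \<and> \<phi> ^^ k = id" if "n > 0" "\<phi> ^^ n = id" for n
    using that
  proof (induction n rule: less_induct)
    case (less n)
    show ?case
    proof (cases "even n")
      case True
      then obtain m where m: "n = m + m" by (metis evenE mult_2)
      have "(\<phi> ^^ m) ((\<phi> ^^ m) u) = u" for u
        using less.prems(2) by (simp add: m funpow_add fun_eq_iff)
      then have "\<phi> ^^ m = id"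
        by (rule involution_eq_id[OF automorphism_funpow[OF \<phi>]])
      then show ?thesis using less.IH[of m] less.prems(1) m by simp
    qed (use less.prems in blast)
  qed
  moreover have "permutation \<phi>"
    using \<phi> finite_verts permutation_permutes by (auto simp: automorphism_def)
  ultimately show thesis using that permutation_is_nilpotent by metis
qed

lemma odd_action_automorphisms: "odd_action {\<phi>. automorphism H \<phi>} (pverts H)"
proof
  show "\<exists>k. odd k \<and> (\<forall>u\<in>pverts H. (\<phi> ^^ k) u = u)" if "\<phi> \<in> {\<phi>. automorphism H \<phi>}" for \<phi>
    using automorphism_odd_order[of \<phi>] that by (metis id_apply mem_Collect_eq)
qed (use finite_verts automorphism_id automorphism_comp automorphism_mem in auto)

lemma ex_asymmetric_vertex_set:
  obtains S where "S \<subseteq> pverts H" "\<And>\<phi>. automorphism H \<phi> \<Longrightarrow> \<phi> ` S = S \<Longrightarrow> \<phi> = id"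
proof -
  obtain S where S: "asymmetric_set {\<phi>. automorphism H \<phi>} (pverts H) S"
    using odd_action_asymmetric_set[OF odd_action_automorphisms] by blast
  show thesis
  proof (rule that)
    show "\<phi> = id" if "automorphism H \<phi>" "\<phi> ` S = S" for \<phi>
      using S that by (intro automorphism_eq_id) (auto simp: asymmetric_set_def)
  qed (use S in \<open>simp add: asymmetric_set_def\<close>)
qed

section \<open>Distinguishing labellings and colourings of tournaments\<close>

lemma automorphism_image_eq:
  assumes \<phi>: "automorphism H \<phi>" and S: "S \<subseteq> pverts H"
    and iff: "\<And>u. u \<in> pverts H \<Longrightarrow> \<phi> u \<in> S \<longleftrightarrow> u \<in> S"
  shows "\<phi> ` S = S"
proof
  show "\<phi> ` S \<subseteq> S" using S iff by blast
  show "S \<subseteq> \<phi> ` S"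
  proof
    fix v assume v: "v \<in> S"
    then have "v \<in> \<phi> ` pverts H" using S automorphism_image[OF \<phi>] by blast
    then obtain u where "u \<in> pverts H" "v = \<phi> u" by (rule imageE)
    then show "v \<in> \<phi> ` S" using v iff by blast
  qed
qed

lemma ex_distinguishing_2_labelling: "\<exists>l. vertex_labelling H 2 l \<and> vertex_distinguishing H l"
proof -
  obtain S where S: "S \<subseteq> pverts H" "\<And>\<phi>. automorphism H \<phi> \<Longrightarrow> \<phi> ` S = S \<Longrightarrow> \<phi> = id"
    using ex_asymmetric_vertex_set by metis
  let ?l = "\<lambda>u. if u \<in> S then 1 else 2 :: nat"
  have "\<phi> = id" if "automorphism H \<phi>" "\<forall>u\<in>pverts H. ?l (\<phi> u) = ?l u" for \<phi>
  proof -
    have "\<phi> u \<in> S \<longleftrightarrow> u \<in> S" if "u \<in> pverts H" for u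
      using \<open>\<forall>u\<in>pverts H. ?l (\<phi> u) = ?l u\<close>[rule_format, OF that] by (simp split: if_splits)
    then show ?thesis using S(2) automorphism_image_eq[OF _ S(1)] that(1) by blast
  qed
  then show ?thesis
    by (intro exI[of _ ?l]) (auto simp: vertex_labelling_def vertex_distinguishing_def)
qed

text \<open>Label each arc by the membership of its tail in an asymmetric set; only a sink is the tail of
  no arc, and a sink is unique, hence fixed by every automorphism.\<close>

lemma ex_distinguishing_2_arc_labelling: "\<exists>l. arc_labelling H 2 l \<and> arc_distinguishing H l"
proof -
  obtain S where S: "S \<subseteq> pverts H" "\<And>\<phi>. automorphism H \<phi> \<Longrightarrow> \<phi> ` S = S \<Longrightarrow> \<phi> = id"
    using ex_asymmetric_vertex_set by metis
  let ?l = "\<lambda>(u, v). if u \<in> S then 1 else 2 :: nat"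
  have "\<phi> = id" if \<phi>: "automorphism H \<phi>" and l: "\<forall>(u, v)\<in>parcs H. ?l (\<phi> u, \<phi> v) = ?l (u, v)" for \<phi>
  proof -
    have "\<phi> u \<in> S \<longleftrightarrow> u \<in> S" if u: "u \<in> pverts H" for u
    proof (cases "\<exists>v. (u, v) \<in> parcs H")
      case True
      then obtain v where "(u, v) \<in> parcs H" by blast
      then have "?l (\<phi> u, \<phi> v) = ?l (u, v)" using l by blast
      then show ?thesis by (simp split: if_splits)
    next
      case False
      have "\<phi> u = u"
      proof (rule ccontr)
        assume "\<phi> u \<noteq> u"
        have "u \<in> \<phi> ` pverts H" using u automorphism_image[OF \<phi>] by simp
        then obtain w where w: "w \<in> pverts H" "\<phi> w = u" by (auto elim: imageE)
        have "w \<noteq> u" using \<open>\<phi> u \<noteq> u\<close> w(2) by auto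
        then have "(w, u) \<in> parcs H" using arc_cases[OF w(1) u] False by blast
        then have "(u, \<phi> u) \<in> parcs H" using automorphism_arc[OF \<phi>] w(2) by metis
        then show False using False by blast
      qed
      then show ?thesis by simp
    qed
    then show ?thesis using S(2) automorphism_image_eq[OF \<phi> S(1)] \<phi> by blast
  qed
  then show ?thesis
    by (intro exI[of _ ?l]) (auto simp: arc_labelling_def arc_distinguishing_def)
qed

text \<open>If \<open>\<phi> u \<noteq> u\<close>, then the arc between \<open>u\<close> and \<open>\<phi> u\<close> and its image meet in \<open>\<phi> u\<close> and have the
  same colour, so they coincide, which is impossible.\<close>

lemma arc_colouring_distinguishing:
  assumes "arc_colouring H r l"
  shows "arc_distinguishing H l"
  unfolding arc_distinguishing_def
proof (intro allI impI, elim conjE)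
  fix \<phi> assume \<phi>: "automorphism H \<phi>" and l: "\<forall>(u, v)\<in>parcs H. l (\<phi> u, \<phi> v) = l (u, v)"
  have fixed: "(\<phi> u, \<phi> v) = (u, v)"
    if "(u, v) \<in> parcs H" "{\<phi> u, \<phi> v} \<inter> {u, v} \<noteq> {}" for u v
  proof (rule ccontr)
    assume "(\<phi> u, \<phi> v) \<noteq> (u, v)"
    moreover have "(\<phi> u, \<phi> v) \<in> parcs H" using automorphism_arc[OF \<phi> that(1)] .
    ultimately have "l (\<phi> u, \<phi> v) \<noteq> l (u, v)"
      using assms that unfolding arc_colouring_def by (metis fst_conv snd_conv)
    then show False using l that(1) by blast
  qed
  show "\<phi> = id"
  proof (rule automorphism_eq_id[OF \<phi>], rule ccontr)
    fix u assume u: "u \<in> pverts H" "\<phi> u \<noteq> u"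
    then show False
      using arc_cases[of u "\<phi> u"] fixed[of u "\<phi> u"] fixed[of "\<phi> u" u] automorphism_mem[OF \<phi> u(1)]
      by auto
  qed
qed

lemma vertex_colouring_inj:
  assumes "vertex_colouring H r l"
  shows "inj_on l (pverts H)"
  using assms arc_cases unfolding vertex_colouring_def by (intro inj_onI) (metis (mono_tags, lifting) case_prodD)

text \<open>All pairs are adjacent, so proper colourings are injective, and an injective colouring
  is preserved by the identity alone.\<close>

lemma dist_chromatic_number_eq: "dist_chromatic_number H = card (pverts H)"
  unfolding dist_chromatic_number_def
proof (rule Least_equality)
  obtain l where l: "bij_betw l (pverts H) {1..card (pverts H)}"
    using ex_bij_betw_nat_finite_1[OF finite_verts] bij_betw_inv by blast
  have "vertex_colouring H (card (pverts H)) l"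
    unfolding vertex_colouring_def vertex_labelling_def
    using l no_loop arcs_subset by (auto simp: bij_betw_def dest!: inj_onD)
  moreover have "vertex_distinguishing H l"
    unfolding vertex_distinguishing_def
    using l automorphism_eq_id automorphism_mem by (metis bij_betw_def inj_onD)
  ultimately show "\<exists>l. vertex_colouring H (card (pverts H)) l \<and> vertex_distinguishing H l" by blast
next
  fix r assume "\<exists>l. vertex_colouring H r l \<and> vertex_distinguishing H l"
  then obtain l where l: "vertex_colouring H r l" by blast
  then have "card (pverts H) \<le> card {1..r}"
    using vertex_colouring_inj[OF l]
    by (intro card_inj_on_le) (auto simp: vertex_colouring_def vertex_labelling_def)
  then show "card (pverts H) \<le> r" by simp
qed

lemma dist_number_le_2: "dist_number H \<le> 2"
  unfolding dist_number_def by (rule Least_le) (rule ex_distinguishing_2_labelling)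

lemma dist_index_le_2: "dist_index H \<le> 2"
  unfolding dist_index_def by (rule Least_le) (rule ex_distinguishing_2_arc_labelling)

text \<open>With at most one label the labelling is constant and \<phi> preserves it.\<close>

lemma dist_number_eq_2:
  assumes \<phi>: "automorphism H \<phi>" "\<phi> \<noteq> id"
  shows "dist_number H = 2"
proof -
  obtain l where l: "vertex_labelling H (dist_number H) l" "vertex_distinguishing H l"
    using LeastI_ex[of "\<lambda>r. \<exists>l. vertex_labelling H r l \<and> vertex_distinguishing H l"]
      ex_distinguishing_2_labelling unfolding dist_number_def by blast
  have "\<not> dist_number H \<le> 1"
  proof
    assume "dist_number H \<le> 1"
    then have "l u = 1" if "u \<in> pverts H" for u
      using funcset_mem[OF l(1)[unfolded vertex_labelling_def] that] by simp
    then show False using l(2) \<phi> automorphism_mem[OF \<phi>(1)] by (simp add: vertex_distinguishing_def)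
  qed
  then show ?thesis using dist_number_le_2 by simp
qed

lemma dist_index_eq_2:
  assumes \<phi>: "automorphism H \<phi>" "\<phi> \<noteq> id"
  shows "dist_index H = 2"
proof -
  obtain l where l: "arc_labelling H (dist_index H) l" "arc_distinguishing H l"
    using LeastI_ex[of "\<lambda>r. \<exists>l. arc_labelling H r l \<and> arc_distinguishing H l"]
      ex_distinguishing_2_arc_labelling unfolding dist_index_def by blast
  have "\<not> dist_index H \<le> 1"
  proof
    assume "dist_index H \<le> 1"
    then have "l a = 1" if "a \<in> parcs H" for a
      using funcset_mem[OF l(1)[unfolded arc_labelling_def] that] by simp
    then have "\<forall>(u, v)\<in>parcs H. l (\<phi> u, \<phi> v) = l (u, v)"
      using automorphism_arc[OF \<phi>(1)] by auto
    then show False using l(2) \<phi> by (auto simp: arc_distinguishing_def)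
  qed
  then show ?thesis using dist_index_le_2 by simp
qed

end

section \<open>Orientations of the complete graph\<close>

lemma orientation_iff:
  assumes "complete_digraph n (with_proj G)"
  shows "H \<in> orientations G \<longleftrightarrow> pverts H = pverts G \<and> tournament H"
proof -
  have fin: "finite (pverts G)" and arcs: "parcs G = {(u, v). u \<in> pverts G \<and> v \<in> pverts G \<and> u \<noteq> v}"
    using assms by (auto simp: complete_digraph_pair_def)
  show ?thesis
  proof
    assume "H \<in> orientations G"
    then have H: "pverts H = pverts G" "parcs H \<subseteq> parcs G"
      "\<forall>(u, v)\<in>parcs G. (u, v) \<in> parcs H \<longleftrightarrow> (v, u) \<notin> parcs H"
      by (auto simp: orientations_def)
    have "tournament H"
    proof
      show "(u, v) \<in> parcs H \<longleftrightarrow> u \<noteq> v \<and> (v, u) \<notin> parcs H"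
        if "u \<in> pverts H" "v \<in> pverts H" for u v
        using H that unfolding arcs by blast
    qed (use H fin arcs in auto)
    then show "pverts H = pverts G \<and> tournament H" using H by simp
  next
    assume H: "pverts H = pverts G \<and> tournament H"
    then interpret tournament H by simp
    have "parcs H \<subseteq> parcs G" using H arcs_subset no_loop unfolding arcs by auto
    moreover have "(u, v) \<in> parcs H \<longleftrightarrow> (v, u) \<notin> parcs H" if "(u, v) \<in> parcs G" for u v
      using that H arc_iff[of u v] by (simp add: arcs)
    ultimately show "H \<in> orientations G" using H by (auto simp: orientations_def)
  qed
qed

lemma finite_orientations:
  assumes "finite (parcs G)"
  shows "finite (orientations G)"
proof (rule finite_subset)
  show "orientations G \<subseteq> (\<lambda>A. \<lparr>pverts = pverts G, parcs = A\<rparr>) ` Pow (parcs G)"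
    by (auto simp: orientations_def image_iff intro!: pair_pre_digraph.equality)
qed (use assms in simp)

text \<open>A cyclic triangle dominated by a transitive tournament on the remaining vertices.\<close>

lemma ex_tournament_automorphism:
  assumes V: "finite V" "card V \<ge> 3"
  obtains H \<phi> where "pverts H = V" "tournament H" "automorphism H \<phi>" "\<phi> \<noteq> id"
proof -
  obtain T where "T \<subseteq> V" "card T = 3" using V by (metis obtain_subset_with_card_n)
  then obtain a b c where abc: "{a, b, c} \<subseteq> V" "a \<noteq> b" "b \<noteq> c" "c \<noteq> a"
    by (auto simp: card_3_iff)
  \<comment> \<open>\<open>i\<close> supplies the linear order for the transitive part, and \<phi>
    below rotates the triangle.\<close>
  obtain i :: "'a \<Rightarrow> nat" where i: "inj_on i V" using finite_imp_inj_to_nat_seg[OF V(1)] by blast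
  define A where "A = {(a, b), (b, c), (c, a)} \<union> (V - {a, b, c}) \<times> {a, b, c}
    \<union> {(u, v) \<in> (V - {a, b, c}) \<times> (V - {a, b, c}). i u < i v}"
  define H where "H = \<lparr>pverts = V, parcs = A\<rparr>"
  define \<phi> where "\<phi> = (\<lambda>x. if x = a then b else if x = b then c else if x = c then a else x)"
  have "tournament H"
  proof
    show "(u, v) \<in> parcs H \<longleftrightarrow> u \<noteq> v \<and> (v, u) \<notin> parcs H" if "u \<in> pverts H" "v \<in> pverts H" for u v
    proof (cases "u \<in> {a, b, c} \<or> v \<in> {a, b, c}")
      case True
      then show ?thesis using that abc by (auto simp: H_def A_def)
    next
      case False
      moreover have "i u \<noteq> i v" if "u \<noteq> v"
        using inj_onD[OF i] that \<open>u \<in> pverts H\<close> \<open>v \<in> pverts H\<close> by (auto simp: H_def)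
      ultimately show ?thesis using that by (auto simp: H_def A_def)
    qed
  qed (use V(1) abc in \<open>auto simp: H_def A_def\<close>)
  moreover have "automorphism H \<phi>"
    unfolding automorphism_def
  proof
    have "inj_on \<phi> V" using abc by (auto simp: inj_on_def \<phi>_def)
    moreover have "\<phi> ` V \<subseteq> V" using abc by (auto simp: \<phi>_def)
    ultimately have "bij_betw \<phi> V V" using endo_inj_surj[OF V(1)] by (auto simp: bij_betw_def)
    then show "\<phi> permutes pverts H"
      using abc by (intro bij_imp_permutes) (auto simp: H_def \<phi>_def)
    show "\<forall>(u, v)\<in>parcs H. (\<phi> u, \<phi> v) \<in> parcs H"
      using abc by (auto simp: H_def A_def \<phi>_def)
  qed
  moreover have "\<phi> \<noteq> id" using abc by (auto simp: \<phi>_def fun_eq_iff)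
  ultimately show thesis using that[of H \<phi>] by (simp add: H_def)
qed

text \<open>Forgetting directions matches arcs with edges and preserves incidence, so arc colourings
  correspond to edge colourings; they are distinguishing by
  \<open>arc_colouring_distinguishing\<close>.\<close>

lemma dist_chromatic_index_eq:
  assumes G: "complete_digraph n (with_proj G)" and H: "H \<in> orientations G"
  shows "dist_chromatic_index H = chromatic_index G"
proof -
  have arcs: "parcs G = {(u, v). u \<in> pverts G \<and> v \<in> pverts G \<and> u \<noteq> v}"
    using G by (auto simp: complete_digraph_pair_def)
  interpret tournament H using H orientation_iff[OF G] by blast
  have verts: "pverts H = pverts G" using H orientation_iff[OF G] by blast
  let ?e = "\<lambda>a. {fst a, snd a}"
  have bij: "bij_betw ?e (parcs H) (edges G)"
  proof (rule bij_betwI')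
    show "?e a = ?e b \<longleftrightarrow> a = b" if "a \<in> parcs H" "b \<in> parcs H" for a b
      using that no_reverse by (cases a; cases b) (auto simp: doubleton_eq_iff)
    show "?e a \<in> edges G" if "a \<in> parcs H" for a
      using that arcs_subset no_loop[of "fst a"] verts unfolding edges_def arcs by (cases a) fastforce
    show "\<exists>a\<in>parcs H. e = ?e a" if e: "e \<in> edges G" for e
    proof -
      obtain u v where uv: "e = {u, v}" "u \<in> pverts H" "v \<in> pverts H" "u \<noteq> v"
        using e unfolding edges_def arcs verts by blast
      from uv(2-4) show ?thesis
      proof (cases rule: arc_cases)
        case 1
        then show ?thesis using uv(1) by (intro bexI[of _ "(u, v)"]) auto
      next
        case 2
        then show ?thesis using uv(1) by (intro bexI[of _ "(v, u)"]) auto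
      qed
    qed
  qed
  have "(\<exists>l. arc_colouring H r l \<and> arc_distinguishing H l) \<longleftrightarrow> (\<exists>c. edge_colouring G r c)" for r
  proof
    assume "\<exists>l. arc_colouring H r l \<and> arc_distinguishing H l"
    then obtain l where l: "arc_colouring H r l" by blast
    \<comment> \<open>\<open>?a\<close> returns the arc of \<open>H\<close> that orients a given
      edge.\<close>
    let ?a = "inv_into (parcs H) ?e"
    have a: "?a e \<in> parcs H" "?e (?a e) = e" if "e \<in> edges G" for e
      using that inv_into_into[of e ?e "parcs H"] f_inv_into_f[of e ?e "parcs H"]
        bij_betw_imp_surj_on[OF bij] by simp_all
    have "edge_colouring G r (l \<circ> ?a)"
      unfolding edge_colouring_def
    proof (intro conjI ballI impI)
      show "l \<circ> ?a \<in> edges G \<rightarrow> {1..r}"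
        using l a(1) by (auto simp: arc_colouring_def arc_labelling_def Pi_iff)
      fix e f assume ef: "e \<in> edges G" "f \<in> edges G" "e \<noteq> f \<and> e \<inter> f \<noteq> {}"
      have "?a e \<noteq> ?a f" using a(2)[OF ef(1)] a(2)[OF ef(2)] ef(3) by metis
      moreover have "?e (?a e) \<inter> ?e (?a f) \<noteq> {}"
        unfolding a(2)[OF ef(1)] a(2)[OF ef(2)] using ef(3) by blast
      ultimately have "l (?a e) \<noteq> l (?a f)"
        using l a(1)[OF ef(1)] a(1)[OF ef(2)] unfolding arc_colouring_def by blast
      then show "(l \<circ> ?a) e \<noteq> (l \<circ> ?a) f" by simp
    qed
    then show "\<exists>c. edge_colouring G r c" by blast
  next
    assume "\<exists>c. edge_colouring G r c"
    then obtain c where c: "edge_colouring G r c" by blast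
    then have c_proper: "c e \<noteq> c f" if "e \<in> edges G" "f \<in> edges G" "e \<noteq> f \<and> e \<inter> f \<noteq> {}" for e f
      using that by (simp add: edge_colouring_def)
    have "arc_colouring H r (c \<circ> ?e)"
      unfolding arc_colouring_def arc_labelling_def
    proof (intro conjI ballI impI)
      have e: "?e a \<in> edges G" if "a \<in> parcs H" for a using bij that by (auto simp: bij_betw_def)
      show "c \<circ> ?e \<in> parcs H \<rightarrow> {1..r}"
        using c e by (simp add: edge_colouring_def Pi_iff)
      fix a b assume ab: "a \<in> parcs H" "b \<in> parcs H" "a \<noteq> b \<and> ?e a \<inter> ?e b \<noteq> {}"
      then have "?e a \<noteq> ?e b"
        using inj_on_eq_iff[OF bij_betw_imp_inj_on[OF bij] ab(1,2)] by blast
      then have "c (?e a) \<noteq> c (?e b)"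
        using c_proper[OF e[OF ab(1)] e[OF ab(2)]] ab(3) by simp
      then show "(c \<circ> ?e) a \<noteq> (c \<circ> ?e) b" by simp
    qed
    then show "\<exists>l. arc_colouring H r l \<and> arc_distinguishing H l"
      using arc_colouring_distinguishing by blast
  qed
  then show ?thesis by (simp add: dist_chromatic_index_def chromatic_index_def)
qed

theorem theorem8:
  fixes G :: "'a pair_pre_digraph" and n :: nat
  assumes "n \<ge> 3"
    and "complete_digraph n (with_proj G)"
  shows "D_max G = 2 \<and> D'_max G = 2 \<and> chi_D_max G = n \<and> chi'_D_max G = chromatic_index G"
proof -
  have G: "finite (pverts G)" "card (pverts G) = n" "finite (parcs G)"
    using assms(2) finite_subset[of "parcs G" "pverts G \<times> pverts G"]
    by (auto simp: complete_digraph_pair_def)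
  note orientation = orientation_iff[OF assms(2)]
  obtain H \<phi> where H: "pverts H = pverts G" "tournament H" "automorphism H \<phi>" "\<phi> \<noteq> id"
    using ex_tournament_automorphism[OF G(1)] G(2) assms(1) by metis
  then have H_mem: "H \<in> orientations G" using orientation by blast
  have fin: "finite (orientations G)" using finite_orientations G(3) .
  \<comment> \<open>\<open>H_mem\<close> guarantees that the maximum is over a nonempty set.\<close>
  have const: "Max (f ` orientations G) = k" if "\<And>H. H \<in> orientations G \<Longrightarrow> f H = k" for f and k :: nat
  proof -
    have "f ` orientations G = {k}" using that H_mem by auto
    then show ?thesis by simp
  qed
  have "D_max G = 2"
    unfolding D_max_def
  proof (rule Max_eqI)
    show "k \<le> 2" if "k \<in> dist_number ` orientations G" for k
      using that orientation tournament.dist_number_le_2 by auto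
    show "2 \<in> dist_number ` orientations G"
      using tournament.dist_number_eq_2[OF H(2-4)] H_mem by (metis imageI)
  qed (use fin in simp)
  moreover have "D'_max G = 2"
    unfolding D'_max_def
  proof (rule Max_eqI)
    show "k \<le> 2" if "k \<in> dist_index ` orientations G" for k
      using that orientation tournament.dist_index_le_2 by auto
    show "2 \<in> dist_index ` orientations G"
      using tournament.dist_index_eq_2[OF H(2-4)] H_mem by (metis imageI)
  qed (use fin in simp)
  moreover have "dist_chromatic_number H = n" if "H \<in> orientations G" for H
    using that orientation tournament.dist_chromatic_number_eq[of H] G(2) by simp
  then have "chi_D_max G = n" unfolding chi_D_max_def by (rule const)
  moreover have "chi'_D_max G = chromatic_index G"
    unfolding chi'_D_max_def using dist_chromatic_index_eq[OF assms(2)] by (rule const)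
  ultimately show ?thesis by simp
qed

end
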